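(* Let $\Gamma=\mathrm{SL}(2,\mathbb Z)$, let $\delta_0$ be the positive constant of the effective equidistribution theorem for $\mathrm{SL}(2,\mathbb Z)$ recalled in the context, and let $\mathbf v,\mathbf u\in\mathcal P$. Then: (1) If $\mathbf u$ has $\beta$-diophantine slope, then there are positive constants $C$ and $T_0$ such that for all $T\ge T_0$ there is $\gamma\in\Gamma_T$ such that $$|\gamma\mathbf u-\mathbf v|<C\,T^{-\frac{2\delta_0}{3\beta}}.$$ (2) If the slope of $\mathbf u$ is irrational, then there is a positive constant $C$ such that there are infinitely many $\gamma\in\Gamma$ solving $$|\gamma\mathbf u-\mathbf v|<C\,\|\gamma\|^{-\frac{\delta_0}{3}}.$$
   Context: $G=\mathrm{SL}(2,\mathbb R)$ acts on $\mathcal P=\mathbb R^2\smallsetminus\{0\}$ (column vectors) by matrix multiplication. A norm $\|\cdot\|$ on the space $M_2(\mathbb R)$ of real $2\times2$ matrices is fixed. For $T>0$, $\Gamma_T=\{\gamma\in\Gamma:\|\gamma\|\le T\}$ and $S_{f,\mathbf u}(T)=\sum_{\gamma\in\Gamma_T}f(\gamma\mathbf u)$. For $\mathbf v=(v_1,v_2)^t$, $\mathbf u=(u_1,u_2)^t$ put $|\mathbf v|=\max\{|v_1|,|v_2|\}$ and $\mathbf v\star\mathbf u=\left\|\begin{bmatrix}-u_2v_1&u_1v_1\\ -u_2v_2&u_1v_2\end{bmatrix}\right\|$. $d\mathbf v$ is Lebesgue measure. The slope of $\mathbf u$ is $u_2/u_1$ (a vertical vector counts as having rational slope). For $\beta>0$,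 $z\in\mathbb R$ is $\beta$-diophantine if there is $c>0$ such that $|z-p/q|\ge c\,q^{-\beta}$ for all integers $p$ and $q\ge1$; the definition is extended to $\beta=+\infty$ with the convention that every number (even rational) is $\infty$-diophantine. The theorem defining $\delta_0$: for $\Gamma=\mathrm{SL}(2,\mathbb Z)$ there are positive constants $c$ and $\delta_0$ such that for any $\theta\in(0,1]$ there exists $C>0$ such that for any $\mathbf u\in\mathcal P$ and any compactly supported $\theta$-Hölder $f:\mathcal P\to\mathbb R$, with $D_0=\max\left(\frac{R(f)}{|\mathbf u|},\frac{|\mathbf u|}{r(f)}\right)$, $B=\left(\frac{R(f)}{|\mathbf u|}\right)^{-\theta\delta_0}(\log v(f)+1)$ and $\hat\xi_{f,T,\mathbf u}=\hat\xi\left(\mathbf u,\log\frac{T|\mathbf u|}{R(f)},\log\frac{T|\mathbf u|}{r(f)}\right)$, for any $T>cD_0$ with $T\ge c\,|\mathbf u|\,\hat\xi_{f,T,\mathbf u}/R(f)$ one has $$\left|S_{f,\mathbf u}(T)-\frac{2T}{\mu(\Gamma\backslash G)}\int_{\mathcal P}\frac{f(\mathbf v)}{\mathbf v\star\mathbf u}\,d\mathbf v\right|\le C\|f\|_\theta\frac{R(f)}{|\mathbf u|}\left(D_0+BT^{1-\theta\delta_0}\hat\xi_{f,T,\mathbf u}^{\theta\delta_0}\right).$$ Notation in that theorem. $r(f)=\inf_{\mathbf v\in\operatorname{supp}f}|\mathbf v|$, $R(f)=\sup_{\mathbf v\in\operatorname{supp}f}|\mathbf v|$, $v(f)=R(f)/r(f)$.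 A continuous compactly supported $f:\mathcal P\to\mathbb R$ is $\theta$-Hölder if $$\|f\|_\theta=\sup|f|+\left(\int_{\mathcal P}f(\mathbf v)^2\frac{d\mathbf v}{|\mathbf v|^2}\right)^{1/2}+\sup_{0<|x-y|\le|x|/2}\frac{|x|^\theta|f(x)-f(y)|}{|x-y|^\theta}<\infty.$$ Every $g\in G$ is uniquely $g=\Psi(\mathbf v)h_s$ with $\mathbf v\in\mathcal P$, $s\in\mathbb R$, where $\Psi\left(\begin{bmatrix}x\\ y\end{bmatrix}\right)=\begin{bmatrix}x&-y/(x^2+y^2)\\ y&x/(x^2+y^2)\end{bmatrix}$, $h_s=\begin{bmatrix}1&s\\ 0&1\end{bmatrix}$; $\mu$ on $G$ is the Haar measure $d\mathbf v\,ds$ in these coordinates and $\mu$ on $\Gamma\backslash G$ is the induced measure. Definition of $\hat\xi$. Let $z\in[0,1)$ have continued fraction expansion $z=[0;a_1,a_2,\dots]$ and convergents $p_k/q_k$, and let $t_k=-\log|z-p_k/q_k|$, an increasing sequence. If $z$ is irrational, $\hat\xi(z,\tau_1,\tau_2)=\max\left(a_k:\ \tau_1\le t_{k+1},\ t_{k-1}\le\tau_2\right)$, and $e^{\tau_2}$ if the set on the right is empty. If $z$ is rational, the sequences $(a_k),(q_k),(t_k)$ are finite; let $k_0$ be the length, that is $z=p_{k_0}/q_{k_0}$. If $\tau_2\le t_{k_0-1}$, $\hat\xi(z,\tau_1,\tau_2)$ is defined by the preceding formula; if not, $\hat\xi(z,\tau_1,\tau_2)=\min\left(e^{\tau_2},\max\left(\max\{a_k:\tau_1\le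 t_{k+1}\},e^{\tau_2}/q_{k_0}^2\right)\right)$. For $\mathbf u=(\mathbf u_x,\mathbf u_y)^t\in\mathcal P$, $\hat\xi(\mathbf u,\tau_1,\tau_2)=\hat\xi(z,\tau_1,\tau_2)$ where $z$ is the unique real number in $[0,1)\cap\{\mathbf u_x/\mathbf u_y,\ \mathbf u_x/\mathbf u_y+1,\ -\mathbf u_y/\mathbf u_x,\ -\mathbf u_y/\mathbf u_x+1\}$. *)

theory Defs
  imports "HOL-Analysis.Analysis"
begin

definition punctured_plane :: "(real^2) set" where
  "punctured_plane = UNIV - {0}"

definition maxnorm :: "real^2 \<Rightarrow> real" where
  "maxnorm x = max \<bar>x$1\<bar> \<bar>x$2\<bar>"

definition matrix_norm :: "(real^2^2 \<Rightarrow> real) \<Rightarrow> bool" where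
  "matrix_norm N \<longleftrightarrow>
     (\<forall>A. 0 \<le> N A) \<and> (\<forall>A. N A = 0 \<longleftrightarrow> A = 0) \<and>
     (\<forall>c A. N (c *\<^sub>R A) = \<bar>c\<bar> * N A) \<and> (\<forall>A B. N (A + B) \<le> N A + N B)"

definition SL2R :: "(real^2^2) set" where
  "SL2R = {A. det A = 1}"

definition SL2Z :: "(real^2^2) set" where
  "SL2Z = {A. det A = 1 \<and> (\<forall>i j. A$i$j \<in> \<int>)}"

definition SL2Z_ball :: "(real^2^2 \<Rightarrow> real) \<Rightarrow> real \<Rightarrow> (real^2^2) set" where
  "SL2Z_ball N T = {g \<in> SL2Z. N g \<le> T}"

definition orbit_sum :: "(real^2^2 \<Rightarrow> real) \<Rightarrow> (real^2 \<Rightarrow> real) \<Rightarrow> real^2 \<Rightarrow> real \<Rightarrow> real" where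
  "orbit_sum N f u T = (\<Sum>g\<in>SL2Z_ball N T. f (g *v u))"

definition star :: "(real^2^2 \<Rightarrow> real) \<Rightarrow> real^2 \<Rightarrow> real^2 \<Rightarrow> real" where
  "star N v u = N (vector [vector [- u$2 * v$1, u$1 * v$1],
                           vector [- u$2 * v$2, u$1 * v$2]])"

definition Psi :: "real^2 \<Rightarrow> real^2^2" where
  "Psi v = vector [vector [v$1, - v$2 / ((v$1)^2 + (v$2)^2)],
                   vector [v$2,   v$1 / ((v$1)^2 + (v$2)^2)]]"

definition horo :: "real \<Rightarrow> real^2^2" where
  "horo s = vector [vector [1, s], vector [0, 1]]"

text \<open>The Haar measure of \<open>SL(2,\<real>)\<close>, as a Borel measure on the space of all
  matrices that is carried by \<open>SL(2,\<real>)\<close>.\<close>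

definition haar :: "(real^2^2) measure" where
  "haar = distr (restrict_space lborel punctured_plane \<Otimes>\<^sub>M lborel) borel
            (\<lambda>(v, s). Psi v ** horo s)"

definition strict_fundamental_domain :: "(real^2^2) set \<Rightarrow> bool" where
  "strict_fundamental_domain F \<longleftrightarrow>
     F \<in> sets borel \<and> F \<subseteq> SL2R \<and> (\<forall>g\<in>SL2R. \<exists>!\<gamma>. \<gamma> \<in> SL2Z \<and> \<gamma> ** g \<in> F)"

text \<open>The total mass of the measure induced by \<open>haar\<close> on the quotient of \<open>SL(2,\<real>)\<close> by left
  multiplication by \<open>SL(2,\<int>)\<close>: the Haar measure of any Borel set of
  representatives of the orbits. Since \<open>SL(2,\<int>)\<close> is countable and preserves \<open>haar\<close>, this does not
  depend on the set.\<close>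

definition covolume :: real where
  "covolume = (THE c. \<exists>F. strict_fundamental_domain F \<and> c = measure haar F)"

text \<open>The expansion of \<open>z \<in> [0,1)\<close> produced by the Gauss map; for rational \<open>z\<close>
  this is the expansion with last digit at least 2. Once a remainder vanishes, all later
  remainders and digits are \<open>0\<close>, because \<open>1 / 0 = 0\<close>; they are not part of the expansion and are
  excluded by \<open>cf_index\<close>.\<close>

fun cf_rem :: "real \<Rightarrow> nat \<Rightarrow> real" where
  "cf_rem z 0 = z"
| "cf_rem z (Suc k) = frac (1 / cf_rem z k)"

definition cf_digit :: "real \<Rightarrow> nat \<Rightarrow> int" where
  "cf_digit z k = \<lfloor>1 / cf_rem z (k - 1)\<rfloor>"

fun cf_num :: "real \<Rightarrow> nat \<Rightarrow> int" where
  "cf_num z 0 = 0"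
| "cf_num z (Suc 0) = 1"
| "cf_num z (Suc (Suc k)) = cf_digit z (Suc (Suc k)) * cf_num z (Suc k) + cf_num z k"

fun cf_den :: "real \<Rightarrow> nat \<Rightarrow> int" where
  "cf_den z 0 = 1"
| "cf_den z (Suc 0) = cf_digit z 1"
| "cf_den z (Suc (Suc k)) = cf_digit z (Suc (Suc k)) * cf_den z (Suc k) + cf_den z k"

definition cf_length :: "real \<Rightarrow> nat" where
  "cf_length z = (LEAST k. cf_rem z k = 0)"

definition cf_index :: "real \<Rightarrow> nat set" where
  "cf_index z = {k. 1 \<le> k \<and> (z \<in> \<rat> \<longrightarrow> k \<le> cf_length z)}"

text \<open>The times \<open>t\<^sub>k\<close>. For rational \<open>z\<close> the last convergent is \<open>z\<close> itself, so that
  \<open>t\<^sub>k = - log 0 = \<infinity>\<close> at the last index; the sequence is continued by \<open>\<infinity>\<close>, so that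
  a condition \<open>\<tau>\<^sub>1 \<le> t\<^sub>k\<close> past the end of the expansion is vacuous.\<close>

definition cf_time :: "real \<Rightarrow> nat \<Rightarrow> ereal" where
  "cf_time z k =
     (if z \<in> \<rat> \<and> cf_length z \<le> k then \<infinity>
      else ereal (- ln \<bar>z - real_of_int (cf_num z k) / real_of_int (cf_den z k)\<bar>))"

definition xi_window :: "real \<Rightarrow> real \<Rightarrow> real \<Rightarrow> real" where
  "xi_window z \<tau>1 \<tau>2 =
     (let A = {real_of_int (cf_digit z k) | k.
                 k \<in> cf_index z \<and> ereal \<tau>1 \<le> cf_time z (k + 1) \<and> cf_time z (k - 1) \<le> ereal \<tau>2}
      in if A = {} then exp \<tau>2 else Max A)"

text \<open>For \<open>z = 0\<close> the expansion has length 0 and \<open>t\<^bsub>-1\<^esub>\<close> is read as \<open>- \<infinity>\<close> (the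
  convergent of index \<open>-1\<close> is \<open>1/0\<close>), so the second case applies; there the maximum over no digits
  does not contribute, and the value is \<open>exp \<tau>2\<close>.\<close>

definition xi_real :: "real \<Rightarrow> real \<Rightarrow> real \<Rightarrow> real" where
  "xi_real z \<tau>1 \<tau>2 =
     (if z \<notin> \<rat> \<or> (1 \<le> cf_length z \<and> ereal \<tau>2 \<le> cf_time z (cf_length z - 1))
      then xi_window z \<tau>1 \<tau>2
      else min (exp \<tau>2)
             (Max (insert (exp \<tau>2 / (real_of_int (cf_den z (cf_length z)))^2)
                {real_of_int (cf_digit z k) | k. k \<in> cf_index z \<and> ereal \<tau>1 \<le> cf_time z (k + 1)})))"

text \<open>When a coordinate of \<open>u\<close> vanishes, the quotients by it take the value \<open>0\<close> here instead of
  being absent; the representative is \<open>0\<close> either way.\<close>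

definition slope_rep :: "real^2 \<Rightarrow> real" where
  "slope_rep u =
     (THE z. z \<in> {0..<1} \<inter> {u$1 / u$2, u$1 / u$2 + 1, - u$2 / u$1, - u$2 / u$1 + 1})"

definition xi_hat :: "real^2 \<Rightarrow> real \<Rightarrow> real \<Rightarrow> real" where
  "xi_hat u \<tau>1 \<tau>2 = xi_real (slope_rep u) \<tau>1 \<tau>2"

text \<open>Compactly supported functions on the punctured plane are represented by their extension by
  zero to the plane.\<close>

definition supp :: "(real^2 \<Rightarrow> real) \<Rightarrow> (real^2) set" where
  "supp f = closure {x. f x \<noteq> 0}"

definition outer_radius :: "(real^2 \<Rightarrow> real) \<Rightarrow> real" where
  "outer_radius f = (SUP x\<in>supp f. maxnorm x)"

definition inner_radius :: "(real^2 \<Rightarrow> real) \<Rightarrow> real" where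
  "inner_radius f = (INF x\<in>supp f. maxnorm x)"

definition holder_norm :: "real \<Rightarrow> (real^2 \<Rightarrow> real) \<Rightarrow> ereal" where
  "holder_norm \<theta> f =
     (SUP x\<in>punctured_plane. ereal \<bar>f x\<bar>)
     + ereal (sqrt (LINT x:punctured_plane|lborel. (f x)^2 / (maxnorm x)^2))
     + (SUP (x, y)\<in>{(x, y). 0 < maxnorm (x - y) \<and> maxnorm (x - y) \<le> maxnorm x / 2}.
          ereal (maxnorm x powr \<theta> * \<bar>f x - f y\<bar> / maxnorm (x - y) powr \<theta>))"

definition holder :: "real \<Rightarrow> (real^2 \<Rightarrow> real) \<Rightarrow> bool" where
  "holder \<theta> f \<longleftrightarrow>
     continuous_on punctured_plane f \<and> compact (supp f) \<and> supp f \<subseteq> punctured_plane \<and>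
     holder_norm \<theta> f < \<infinity>"

text \<open>For \<open>f = 0\<close> the radii are meaningless, but then both sides of the estimate vanish.\<close>

definition equidistribution_exponent :: "(real^2^2 \<Rightarrow> real) \<Rightarrow> real \<Rightarrow> bool" where
  "equidistribution_exponent N \<delta>0 \<longleftrightarrow> 0 < \<delta>0 \<and>
     (\<exists>c>0. \<forall>\<theta>. 0 < \<theta> \<and> \<theta> \<le> 1 \<longrightarrow> (\<exists>C>0. \<forall>u\<in>punctured_plane. \<forall>f. holder \<theta> f \<longrightarrow>
       (let R = outer_radius f; r = inner_radius f;
            D0 = max (R / maxnorm u) (maxnorm u / r);
            B = (R / maxnorm u) powr (- \<theta> * \<delta>0) * (ln (R / r) + 1)
        in \<forall>T>0.
          (let \<xi> = xi_hat u (ln (T * maxnorm u / R)) (ln (T * maxnorm u / r))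
           in T > c * D0 \<and> T \<ge> c * maxnorm u * \<xi> / R \<longrightarrow>
              \<bar>orbit_sum N f u T
                - 2 * T / covolume * (LINT v:punctured_plane|lborel. f v / star N v u)\<bar>
              \<le> C * real_of_ereal (holder_norm \<theta> f) * (R / maxnorm u)
                 * (D0 + B * T powr (1 - \<theta> * \<delta>0) * \<xi> powr (\<theta> * \<delta>0))))))"

definition diophantine :: "ereal \<Rightarrow> real \<Rightarrow> bool" where
  "diophantine \<beta> z \<longleftrightarrow> \<beta> = \<infinity> \<or>
     (\<exists>c>0. \<forall>p q :: int. 1 \<le> q \<longrightarrow>
        \<bar>z - real_of_int p / real_of_int q\<bar> \<ge> c * real_of_int q powr (- real_of_ereal \<beta>))"

text \<open>A vertical vector counts as having rational slope; in particular its slope is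
  \<open>\<beta>\<close>-diophantine only for \<open>\<beta> = \<infinity>\<close>.\<close>

definition diophantine_slope :: "ereal \<Rightarrow> real^2 \<Rightarrow> bool" where
  "diophantine_slope \<beta> u \<longleftrightarrow> (if u$1 = 0 then \<beta> = \<infinity> else diophantine \<beta> (u$2 / u$1))"

definition irrational_slope :: "real^2 \<Rightarrow> bool" where
  "irrational_slope u \<longleftrightarrow> u$1 \<noteq> 0 \<and> u$2 / u$1 \<notin> \<rat>"

end

theory Submission
  imports Defs "HOL-Real_Asymp.Real_Asymp"
begin

text \<open>Part (1) applies the equidistribution estimate with \<open>\<theta> = 1\<close> to a Lipschitz bump of width
  \<open>\<epsilon> \<approx> T powr (- 2 \<delta> / (3 \<beta>))\<close> at \<open>v\<close>. A \<open>\<beta>\<close>-diophantine slope forces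
  \<open>\<xi> = O(T powr (1 - 2 / \<beta>))\<close>, so that the main term, of order \<open>T * \<epsilon>^3\<close> for a bump of height \<open>\<epsilon>\<close>,
  beats the error, provided that the covolume is positive and \<open>\<delta> \<le> 1 / 2\<close>.

  Both provisos follow from the estimate itself. The vector \<open>(1, sqrt 2)\<close> is an eigenvector of a
  hyperbolic matrix in SL(2,Z), which gives at least about \<open>T / ln T\<close> orbit points
  in a fixed annulus, while \<open>\<xi>\<close> stays bounded. A main term that is not positive contradicts this
  count, and \<open>\<delta> > 1 / 2\<close> is refuted by test functions concentrated at the orbit points.

  Part (2) only needs an exponent \<open>\<delta> / 3 \<le> 1 / 6\<close>, which two applications of Dirichlet's theorem give
  directly: if \<open>e = m u\<^sub>1 + n u\<^sub>2\<close> is small and \<open>(a, c)\<close> is a primitive vector close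
  to the direction of \<open>v\<close>, a matrix in SL(2,Z) with first row \<open>(m, n)\<close>, followed by one
  with second column \<open>(a, c)\<close>, sends \<open>u\<close> near \<open>v\<close>.\<close>

section \<open>Norms\<close>

text \<open>The exponent is given only through the estimate and \<open>covolume\<close> only through
  a definite description, so whatever the argument needs about them has to be read off from the
  estimate by feeding it suitable functions. The bumps have slope 1, hence height equal to their
  width \<open>\<epsilon>\<close>: their Hoelder norm then stays bounded as
  \<open>\<epsilon>\<close> shrinks, at the price of an integral of order
  \<open>\<epsilon>^3\<close> instead of \<open>\<epsilon>^2\<close>. This is the 3 in the rate.
  Because of the term \<open>D0\<close> the error bound never drops below a constant, so a main term
  \<open>T * \<epsilon>^3\<close> tending to 0 would be useless; hence the interest in an upper
  bound on the exponent. For that bound one function carries a bump at every orbit point of an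
  annulus, so the constants must not depend on the number of bumps. The orbit points are counted by
  means of coprime pairs, and the loss of a logarithm is harmless against a power of
  \<open>T\<close>. In the Dirichlet argument an error of order \<open>q\<close> costs a matrix of
  size \<open>q powr (-5)\<close>, so exponents up to 1/5 are reached, and 1/6 lies below.\<close>

lemma maxnorm_nonneg [simp]: "0 \<le> maxnorm x"
  by (simp add: maxnorm_def)

lemma maxnorm_eq_0_iff [simp]: "maxnorm x = 0 \<longleftrightarrow> x = 0"
  by (auto simp: maxnorm_def vec_eq_iff forall_2 max_def split: if_splits)

lemma maxnorm_zero [simp]: "maxnorm 0 = 0"
  by simp

lemma maxnorm_pos_iff: "0 < maxnorm x \<longleftrightarrow> x \<noteq> 0"
  using maxnorm_nonneg[of x] maxnorm_eq_0_iff[of x] by linarith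

lemma maxnorm_triangle: "maxnorm (x + y) \<le> maxnorm x + maxnorm y"
  unfolding maxnorm_def vector_add_component by linarith

lemma maxnorm_minus_commute: "maxnorm (x - y) = maxnorm (y - x)"
  by (simp add: maxnorm_def abs_minus_commute)

lemma maxnorm_triangle_diff: "maxnorm (x - z) \<le> maxnorm (x - y) + maxnorm (y - z)"
  using maxnorm_triangle[of "x - y" "y - z"] by simp

lemma maxnorm_diff_ge: "maxnorm x - maxnorm y \<le> maxnorm (x - y)"
  using maxnorm_triangle[of "x - y" y] by simp

lemma maxnorm_scaleR: "maxnorm (c *\<^sub>R x) = \<bar>c\<bar> * maxnorm x"
  by (simp add: maxnorm_def abs_mult max_mult_distrib_left)

lemma maxnorm_le_iff: "maxnorm x \<le> e \<longleftrightarrow> \<bar>x$1\<bar> \<le> e \<and> \<bar>x$2\<bar> \<le> e"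
  by (simp add: maxnorm_def)

lemma component_le_maxnorm: "\<bar>x$1\<bar> \<le> maxnorm x" "\<bar>x$2\<bar> \<le> maxnorm x"
  by (simp_all add: maxnorm_def)

lemma maxnorm_le_norm: "maxnorm x \<le> norm x"
  by (simp add: maxnorm_le_iff component_le_norm_cart)

lemma continuous_maxnorm [continuous_intros]:
  "continuous_on S f \<Longrightarrow> continuous_on S (\<lambda>x. maxnorm (f x))"
  unfolding maxnorm_def by (intro continuous_intros)

lemma matrix_norm_zero: "matrix_norm N \<Longrightarrow> N 0 = 0"
  by (simp add: matrix_norm_def)

lemma matrix_norm_triangle_diff:
  assumes "matrix_norm N" shows "\<bar>N A - N B\<bar> \<le> N (A - B)"
proof -
  have "N A \<le> N (A - B) + N B" for A B
    using assms unfolding matrix_norm_def by (metis diff_add_cancel)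
  from this[of A B] this[of B A] moreover have "N (B - A) = N (A - B)"
    using assms unfolding matrix_norm_def
    by (metis abs_minus_cancel abs_one minus_diff_eq mult_1 scaleR_minus1_left)
  ultimately show ?thesis by linarith
qed

lemma matrix_norm_sum:
  assumes "matrix_norm N" "finite I" shows "N (sum f I) \<le> (\<Sum>i\<in>I. N (f i))"
  using assms(2)
proof (induction I rule: finite_induct)
  case empty
  then show ?case using assms(1) by (simp add: matrix_norm_zero)
next
  case (insert i I)
  have "N (f i + sum f I) \<le> N (f i) + N (sum f I)"
    using assms(1) by (simp add: matrix_norm_def)
  with insert show ?case by simp
qed

lemma matrix_norm_le:
  assumes N: "matrix_norm N" obtains K where "0 < K" "\<And>A. N A \<le> K * norm A"
proof
  let ?K = "1 + (\<Sum>b\<in>Basis. N b)"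
  have nn: "0 \<le> N A" for A using N by (simp add: matrix_norm_def)
  show "0 < ?K" using sum_nonneg[of Basis N] nn by simp
  show "N A \<le> ?K * norm A" for A
  proof -
    have "N A = N (\<Sum>b\<in>Basis. (A \<bullet> b) *\<^sub>R b)" by (simp add: euclidean_representation)
    also have "\<dots> \<le> (\<Sum>b\<in>Basis. N ((A \<bullet> b) *\<^sub>R b))" by (rule matrix_norm_sum[OF N]) simp
    also have "\<dots> = (\<Sum>b\<in>Basis. \<bar>A \<bullet> b\<bar> * N b)" using N by (simp add: matrix_norm_def)
    also have "\<dots> \<le> (\<Sum>b\<in>Basis. norm A * N b)"
      by (intro sum_mono mult_right_mono Basis_le_norm nn)
    also have "\<dots> \<le> ?K * norm A" by (simp add: sum_distrib_left algebra_simps)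
    finally show ?thesis .
  qed
qed

lemma matrix_norm_continuous:
  assumes N: "matrix_norm N" shows "continuous_on S N"
proof -
  obtain K where K: "0 < K" "\<And>A. N A \<le> K * norm A" using matrix_norm_le[OF N] by blast
  have "K-lipschitz_on S N"
    using K matrix_norm_triangle_diff[OF N]
    by (intro lipschitz_onI) (auto simp: dist_norm intro: order_trans)
  then show ?thesis by (rule lipschitz_on_continuous_on)
qed

lemma matrix_norm_ge:
  assumes N: "matrix_norm N" obtains k where "0 < k" "\<And>A. k * norm A \<le> N A"
proof -
  have "\<exists>A\<in>sphere 0 1. \<forall>B\<in>sphere 0 1. N A \<le> N B"
    by (rule continuous_attains_inf) (auto simp: matrix_norm_continuous[OF N])
  then obtain A where A: "norm A = 1" "\<And>B. norm B = 1 \<Longrightarrow> N A \<le> N B" by auto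
  show ?thesis
  proof
    show "0 < N A" using N A(1) unfolding matrix_norm_def
      by (metis norm_zero order_less_le zero_neq_one)
    show "N A * norm B \<le> N B" for B
    proof (cases "B = 0")
      case False
      have "N A \<le> N ((1 / norm B) *\<^sub>R B)" using False by (intro A(2)) simp
      also have "\<dots> = N B / norm B" using N by (simp add: matrix_norm_def)
      finally show ?thesis using False by (simp add: field_simps)
    qed (simp add: matrix_norm_zero[OF N])
  qed
qed

section \<open>Matrices of size two and their integer points\<close>

lemma matrix_vector_mult_2:
  fixes A :: "real^2^2"
  shows "(A *v x)$1 = A$1$1 * x$1 + A$1$2 * x$2" "(A *v x)$2 = A$2$1 * x$1 + A$2$2 * x$2"
  by (simp_all add: matrix_vector_mult_def sum_2)

lemma norm_matrix_le:
  fixes A :: "real^2^2"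
  assumes "\<And>i j. \<bar>A$i$j\<bar> \<le> b" shows "norm A \<le> 4 * b"
proof -
  have "norm (A$i) \<le> 2 * b" for i
    using norm_le_l1_cart[of "A$i"] assms[of i 1] assms[of i 2] by (simp add: sum_2)
  then have "norm A \<le> (\<Sum>i\<in>(UNIV::2 set). 2 * b)"
    unfolding norm_vec_def[of A] by (intro order_trans[OF L2_set_le_sum] sum_mono) auto
  then show ?thesis by simp
qed

text \<open>A sum over an infinite set is 0 by convention; finiteness makes \<open>orbit_sum\<close>
  the actual sum over the ball. The norm controls every entry, and only finitely many integers lie
  in a bounded interval.\<close>

lemma finite_SL2Z_ball:
  assumes N: "matrix_norm N" shows "finite (SL2Z_ball N T)"
proof -
  obtain k where k: "0 < k" "\<And>A. k * norm A \<le> N A" using matrix_norm_ge[OF N] by blast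
  define E where "E = {x::real. x \<in> \<int> \<and> \<bar>x\<bar> \<le> T / k}"
  have "finite E" unfolding E_def by (rule finite_abs_int_segment)
  have "finite {r::real^2. \<forall>j. r$j \<in> E}"
    using finite_PiE[of UNIV "\<lambda>_::2. E"] \<open>finite E\<close>
    by (intro finite_subset[OF _ finite_imageI[of "UNIV \<rightarrow>\<^sub>E E" "\<lambda>f. \<chi> i. f i"]])
       (auto intro!: image_eqI[of _ _ "($) _"] simp: vec_eq_iff)
  then have "finite {A::real^2^2. \<forall>i. A$i \<in> {r. \<forall>j. r$j \<in> E}}"
    using finite_PiE[of UNIV "\<lambda>_::2. {r::real^2. \<forall>j. r$j \<in> E}"]
    by (intro finite_subset[OF _ finite_imageI[of "UNIV \<rightarrow>\<^sub>E {r. \<forall>j. r$j \<in> E}" "\<lambda>f. \<chi> i. f i"]])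
       (auto intro!: image_eqI[of _ _ "($) _"] simp: vec_eq_iff)
  moreover have "SL2Z_ball N T \<subseteq> {A. \<forall>i. A$i \<in> {r. \<forall>j. r$j \<in> E}}"
  proof (clarsimp simp: SL2Z_ball_def SL2Z_def E_def)
    fix A i j assume "N A \<le> T"
    then have "norm A \<le> T / k" using k(2)[of A] k(1) by (simp add: field_simps)
    then show "\<bar>A$i$j\<bar> \<le> T / k"
      using component_le_norm_cart[of "A$i" j] Finite_Cartesian_Product.norm_nth_le[of A i] by linarith
  qed
  ultimately show ?thesis by (rule rev_finite_subset)
qed

text \<open>The matrix inside \<open>star\<close> has rank one: it is the column \<open>v\<close>
  times the row \<open>(-u$2, u$1)\<close>, so its largest entry is
  \<open>maxnorm u * maxnorm v\<close> in absolute value. Equivalence of norms does the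
  rest.\<close>

lemma star_bounds:
  assumes N: "matrix_norm N" and u: "u \<noteq> 0"
  obtains l L where "0 < l" "0 < L" "\<And>v. l * maxnorm v \<le> star N v u" "\<And>v. star N v u \<le> L * maxnorm v"
proof -
  obtain k where k: "0 < k" "\<And>A. k * norm A \<le> N A" using matrix_norm_ge[OF N] by blast
  obtain K where K: "0 < K" "\<And>A. N A \<le> K * norm A" using matrix_norm_le[OF N] by blast
  have u0: "0 < maxnorm u" using u by (simp add: maxnorm_pos_iff)
  define M where "M v = (vector [vector [- u$2 * v$1, u$1 * v$1],
                           vector [- u$2 * v$2, u$1 * v$2]] :: real^2^2)" for v :: "real^2"
  have up: "norm (M v) \<le> 4 * (maxnorm u * maxnorm v)" for v :: "real^2"
  proof (rule norm_matrix_le)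
    have "\<bar>M v$i$1\<bar> \<le> maxnorm u * maxnorm v" "\<bar>M v$i$2\<bar> \<le> maxnorm u * maxnorm v" if "i = 1 \<or> i = 2" for i :: 2
      using that by (auto simp: M_def abs_mult intro!: mult_mono component_le_maxnorm)
    then show "\<bar>M v$i$j\<bar> \<le> maxnorm u * maxnorm v" for i j
      using exhaust_2[of i] exhaust_2[of j] by metis
  qed
  have lo: "maxnorm u * maxnorm v \<le> norm (M v)" for v :: "real^2"
  proof -
    have e: "\<bar>M v$i$j\<bar> \<le> norm (M v)" for i j
      using component_le_norm_cart[of "M v$i" j] Finite_Cartesian_Product.norm_nth_le[of "M v" i] by linarith
    have "\<bar>u$1\<bar> * \<bar>v$1\<bar> \<le> norm (M v)" "\<bar>u$2\<bar> * \<bar>v$1\<bar> \<le> norm (M v)"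
         "\<bar>u$1\<bar> * \<bar>v$2\<bar> \<le> norm (M v)" "\<bar>u$2\<bar> * \<bar>v$2\<bar> \<le> norm (M v)"
      using e[of 1 1] e[of 1 2] e[of 2 1] e[of 2 2] by (simp_all add: M_def abs_mult)
    then show ?thesis unfolding maxnorm_def by (auto simp: max_def)
  qed
  show ?thesis
  proof
    show "0 < k * maxnorm u" "0 < K * (4 * maxnorm u)" using k(1) K(1) u0 by auto
    show "k * maxnorm u * maxnorm v \<le> star N v u" for v
      using mult_left_mono[OF lo[of v] less_imp_le[OF k(1)]] k(2)[of "M v"]
      by (simp add: star_def M_def mult.assoc)
    show "star N v u \<le> K * (4 * maxnorm u) * maxnorm v" for v
      using mult_left_mono[OF up[of v] less_imp_le[OF K(1)]] K(2)[of "M v"]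
      by (simp add: star_def M_def mult.assoc)
  qed
qed

text \<open>Linearity of the matrix in \<open>v\<close> bounds a difference of \<open>star\<close>
  values by the \<open>star\<close> of the difference. Continuity supplies measurability of the
  integrand in the main term.\<close>

lemma continuous_star:
  assumes N: "matrix_norm N" and u: "u \<noteq> 0" shows "continuous_on S (\<lambda>v. star N v u)"
proof -
  obtain l L where L: "0 < L" "\<And>v. star N v u \<le> L * maxnorm v" using star_bounds[OF N u] by metis
  have "\<bar>star N v u - star N w u\<bar> \<le> L * norm (v - w)" for v w
  proof -
    have "\<bar>star N v u - star N w u\<bar> \<le> star N (v - w) u"
      unfolding star_def
      by (rule order_trans[OF matrix_norm_triangle_diff[OF N] eq_refl], rule arg_cong[where f = N])
         (simp add: vec_eq_iff forall_2 algebra_simps)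
    also have "\<dots> \<le> L * norm (v - w)"
      using L(2)[of "v - w"] mult_left_mono[OF maxnorm_le_norm, of L "v - w"] L(1) by linarith
    finally show ?thesis .
  qed
  then have "L-lipschitz_on S (\<lambda>v. star N v u)"
    using L(1) by (intro lipschitz_onI) (auto simp: dist_norm)
  then show ?thesis by (rule lipschitz_on_continuous_on)
qed

section \<open>Continued fractions and diophantine slopes\<close>

lemma ln_le_iff_le_exp: "0 < x \<Longrightarrow> ln x \<le> y \<longleftrightarrow> x \<le> exp (y::real)"
  by (metis exp_le_cancel_iff exp_ln)

lemma cf_rem_irrational:
  assumes "z \<notin> \<rat>" "0 < z" "z < 1"
  shows "cf_rem z k \<notin> \<rat> \<and> 0 < cf_rem z k \<and> cf_rem z k < 1"
proof (induction k)
  case (Suc k)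
  have "frac (1 / cf_rem z k) \<notin> \<rat>"
  proof
    assume "frac (1 / cf_rem z k) \<in> \<rat>"
    then have "1 / cf_rem z k \<in> \<rat>"
      unfolding frac_def using Rats_add[of "1 / cf_rem z k - \<lfloor>1 / cf_rem z k\<rfloor>" "\<lfloor>1 / cf_rem z k\<rfloor>"] by simp
    then have "inverse (1 / cf_rem z k) \<in> \<rat>" by (rule Rats_inverse)
    then show False using Suc by simp
  qed
  moreover from this have "frac (1 / cf_rem z k) \<noteq> 0" by (metis Rats_0)
  ultimately show ?case using frac_ge_0[of "1 / cf_rem z k"] frac_lt_1[of "1 / cf_rem z k"] by simp
qed (use assms in auto)

context
  fixes z :: real
  assumes z: "z \<notin> \<rat>" "0 < z" "z < 1"
begin

lemma cf_rem_bounds: "0 < cf_rem z k" "cf_rem z k < 1"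
  using cf_rem_irrational[OF z] by auto

lemma cf_digit_ge_1: "1 \<le> cf_digit z k"
  unfolding cf_digit_def using cf_rem_bounds[of "k - 1"] by (simp add: le_floor_iff)

lemma cf_rem_step: "cf_rem z k * (cf_digit z (Suc k) + cf_rem z (Suc k)) = 1"
  using cf_rem_bounds[of k] by (simp add: cf_digit_def frac_def)

lemma cf_den_ge_1: "1 \<le> cf_den z k"
proof -
  have "1 \<le> cf_den z k \<and> 1 \<le> cf_den z (Suc k)"
  proof (induction k)
    case 0 then show ?case using cf_digit_ge_1[of 1] by simp
  next
    case (Suc k)
    have "1 * 1 \<le> cf_digit z (Suc (Suc k)) * cf_den z (Suc k)"
      using Suc cf_digit_ge_1[of "Suc (Suc k)"] by (intro mult_mono) auto
    with Suc show ?case by simp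
  qed
  then show ?thesis ..
qed

lemma cf_digit_mult_den_le: "cf_digit z (Suc k) * cf_den z k \<le> cf_den z (Suc k)"
  using cf_den_ge_1[of "k - 1"] by (cases k) auto

lemma cf_den_ge: "int k \<le> cf_den z k"
proof (induction k)
  case (Suc k)
  show ?case
  proof (cases k)
    case 0 then show ?thesis using cf_den_ge_1[of 1] by simp
  next
    case (Suc j)
    have "1 * cf_den z k \<le> cf_digit z (Suc k) * cf_den z k"
      using cf_den_ge_1[of k] cf_digit_ge_1[of "Suc k"] by (intro mult_right_mono) auto
    moreover have "cf_den z (Suc k) = cf_digit z (Suc k) * cf_den z k + cf_den z j" using Suc by simp
    ultimately show ?thesis using Suc.IH cf_den_ge_1[of j] by simp
  qed
qed simp

lemma cf_determinant: "cf_num z (Suc k) * cf_den z k - cf_num z k * cf_den z (Suc k) = (- 1) ^ k"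
  by (induction k) (simp_all add: algebra_simps)

text \<open>One Gauss step gives \<open>r = 1 / (a + r')\<close>; multiplying the identity by
  \<open>a + r'\<close> shifts the recurrence by one index.\<close>

lemma cf_complete_quotient:
  "z * (cf_den z (Suc k) + cf_den z k * cf_rem z (Suc k)) = cf_num z (Suc k) + cf_num z k * cf_rem z (Suc k)"
proof (induction k)
  case 0
  then show ?case using cf_rem_step[of 0] by simp
next
  case (Suc k)
  define r r' where "r = cf_rem z (Suc k)" and "r' = cf_rem z (Suc (Suc k))"
  define a where "a = real_of_int (cf_digit z (Suc (Suc k)))"
  have "r * (a + r') = 1" using cf_rem_step[of "Suc k"] by (simp only: r_def r'_def a_def)
  moreover have "z * (cf_den z (Suc k) + cf_den z k * r) = cf_num z (Suc k) + cf_num z k * r"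
    using Suc by (simp only: r_def)
  ultimately have "z * (cf_den z (Suc k) * (a + r') + cf_den z k) = cf_num z (Suc k) * (a + r') + cf_num z k"
    by algebra
  then show ?case by (simp only: cf_den.simps cf_num.simps flip: r'_def) (simp add: a_def algebra_simps)
qed

text \<open>Subtracting the convergent from the complete quotient formula leaves the determinant of
  two consecutive convergents, which is 1 up to sign, as numerator.\<close>

lemma cf_error:
  "\<bar>z - cf_num z k / cf_den z k\<bar> = 1 / (cf_den z k * (cf_den z (Suc k) + cf_den z k * cf_rem z (Suc k)))"
proof -
  define Q where "Q = cf_den z (Suc k) + cf_den z k * cf_rem z (Suc k)"
  have q: "1 \<le> real_of_int (cf_den z k)" "1 \<le> real_of_int (cf_den z (Suc k))"
    using cf_den_ge_1 by simp_all
  have Q: "0 < Q" unfolding Q_def using q cf_rem_bounds[of "Suc k"] by (intro add_pos_nonneg mult_nonneg_nonneg) auto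
  have "(z * cf_den z k - cf_num z k) * Q = of_int (cf_num z (Suc k) * cf_den z k - cf_num z k * cf_den z (Suc k))"
    using cf_complete_quotient[of k] unfolding Q_def of_int_diff of_int_mult by algebra
  also have "\<dots> = (- 1) ^ k" unfolding cf_determinant by simp
  finally have "\<bar>z * cf_den z k - cf_num z k\<bar> * Q = 1"
    using Q by (metis abs_mult abs_of_pos power_abs abs_minus_cancel abs_1 power_one)
  then have "\<bar>z * cf_den z k - cf_num z k\<bar> = 1 / Q" using Q by (simp add: field_simps)
  moreover have "z - cf_num z k / cf_den z k = (z * cf_den z k - cf_num z k) / cf_den z k"
    using q by (simp add: field_simps)
  ultimately show ?thesis using q by (simp add: Q_def abs_divide)
qed

lemma cf_error_le: "\<bar>z - cf_num z k / cf_den z k\<bar> \<le> 1 / (cf_den z k * cf_den z (Suc k))"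
proof -
  have "1 \<le> real_of_int (cf_den z k)" "1 \<le> real_of_int (cf_den z (Suc k))"
    using cf_den_ge_1 by simp_all
  then show ?thesis
    unfolding cf_error using cf_rem_bounds[of "Suc k"]
    by (intro divide_left_mono mult_left_mono mult_pos_pos add_pos_nonneg) (auto simp: mult_nonneg_nonneg)
qed

lemma cf_time_ge: "ln (cf_den z k * cf_den z (Suc k)) \<le> cf_time z k"
proof -
  have q: "1 \<le> real_of_int (cf_den z k)" "1 \<le> real_of_int (cf_den z (Suc k))"
    using cf_den_ge_1 by simp_all
  have "z - cf_num z k / cf_den z k \<noteq> 0" using z(1) by (metis Rats_divide Rats_of_int eq_iff_diff_eq_0)
  then have "ln \<bar>z - cf_num z k / cf_den z k\<bar> \<le> ln (1 / (cf_den z k * cf_den z (Suc k)))"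
    using q cf_error_le[of k] by (subst ln_le_cancel_iff) auto
  then show ?thesis using q z(1) by (simp add: cf_time_def ln_div)
qed

text \<open>By \<open>cf_time_ge\<close> and the growth of the denominators, the time of index
  \<open>k - 1\<close> is at least \<open>ln k\<close>. Finiteness makes \<open>Max\<close> in
  \<open>xi_window\<close> a genuine maximum.\<close>

lemma cf_window_finite: "finite {k. 1 \<le> k \<and> cf_time z (k - 1) \<le> ereal \<tau>}"
proof (rule finite_subset)
  show "{k. 1 \<le> k \<and> cf_time z (k - 1) \<le> ereal \<tau>} \<subseteq> {..nat \<lceil>exp \<tau>\<rceil>}"
  proof clarsimp
    fix k assume k: "Suc 0 \<le> k" "cf_time z (k - Suc 0) \<le> ereal \<tau>"
    define j where "j = k - 1"
    have kj: "k = Suc j" using k by (simp add: j_def)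
    have q: "1 \<le> real_of_int (cf_den z j)" "real (Suc j) \<le> real_of_int (cf_den z (Suc j))"
      using cf_den_ge_1[of j] cf_den_ge[of "Suc j"] by linarith+
    have "ereal (ln (cf_den z j * cf_den z (Suc j))) \<le> ereal \<tau>"
      using order_trans[OF cf_time_ge k(2)] by (simp add: kj)
    then have "cf_den z j * cf_den z (Suc j) \<le> exp \<tau>"
      using q by (simp add: ln_le_iff_le_exp del: of_int_mult)
    moreover have "1 * real (Suc j) \<le> real_of_int (cf_den z j) * cf_den z (Suc j)"
      using q by (intro mult_mono) auto
    ultimately show "k \<le> nat \<lceil>exp \<tau>\<rceil>" by (simp add: kj) linarith
  qed
qed simp

end

section \<open>Diophantine exponents under inversion, sign change and translation\<close>

text \<open>In this linear form a change of sign or an integer translation of \<open>z\<close> only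
  relabels \<open>p\<close>, and inversion of \<open>z\<close> swaps \<open>p\<close> with
  \<open>q\<close>.\<close>

lemma diophantine_real:
  fixes z :: real shows "diophantine (ereal b) z \<longleftrightarrow> (\<exists>c>0. \<forall>(p::int) (q::int). (1::int) \<le> q \<longrightarrow> c * q powr (1 - b) \<le> \<bar>real_of_int q * z - real_of_int p\<bar>)"
proof -
  have "c * q powr (- b) \<le> \<bar>z - p / q\<bar> \<longleftrightarrow> c * q powr (1 - b) \<le> \<bar>real_of_int q * z - real_of_int p\<bar>" if "(1::int) \<le> q" for c and p q :: int
  proof -
    have "\<bar>real_of_int q * z - real_of_int p\<bar> = q * \<bar>z - p / q\<bar>"
      using that by (subst abs_of_pos[of "real_of_int q", symmetric]) (auto simp: field_simps simp flip: abs_mult)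
    moreover have "q powr (1 - b) = real_of_int q * q powr (- b)"
      using that by (simp add: powr_diff powr_minus field_simps)
    ultimately have "c * q powr (1 - b) \<le> \<bar>real_of_int q * z - real_of_int p\<bar> \<longleftrightarrow> q * (c * q powr (- b)) \<le> q * \<bar>z - p / q\<bar>"
      by (simp add: mult.left_commute)
    then show ?thesis using that by simp
  qed
  then show ?thesis unfolding diophantine_def by auto
qed

lemma diophantine_irrational:
  assumes "diophantine (ereal b) (z::real)" shows "z \<notin> \<rat>"
proof
  assume "z \<in> \<rat>"
  then obtain p q :: int where pq: "z = p / q" "q > 0" by (elim Rats_cases')
  obtain c where c: "0 < c" "\<And>(p::int) (q::int). (1::int) \<le> q \<Longrightarrow> c * q powr (1 - b) \<le> \<bar>real_of_int q * z - real_of_int p\<bar>"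
    using assms unfolding diophantine_real by blast
  have "c * q powr (1 - b) \<le> \<bar>real_of_int q * z - real_of_int p\<bar>" using c(2) pq(2) by simp
  also have "\<dots> = 0" using pq by simp
  finally have "c * q powr (1 - b) \<le> 0" .
  then show False using pq(2) c(1) by (simp add: mult_le_0_iff)
qed

text \<open>Dirichlet's theorem gives, for every \<open>M\<close>, a denominator at most
  \<open>M\<close> with error below \<open>1 / M\<close>; an exponent below 2 would forbid this for
  large \<open>M\<close>.\<close>

lemma diophantine_ge_2:
  assumes "diophantine (ereal b) (z::real)" shows "2 \<le> b"
proof (rule ccontr)
  assume b: "\<not> 2 \<le> b"
  obtain c where c: "0 < c" "\<And>(p::int) (q::int). (1::int) \<le> q \<Longrightarrow> c * q powr (1 - b) \<le> \<bar>real_of_int q * z - real_of_int p\<bar>"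
    using assms unfolding diophantine_real by blast
  \<comment> \<open>Truncation at 0 covers \<open>b < 1\<close>, where \<open>k powr (1 - b)\<close>
    grows with \<open>k\<close>.\<close>
  define m where "m = max 0 (b - 1)"
  have m: "m < 1" using b by (simp add: m_def)
  have ge: "c < real M powr (m - 1)" if M0: "0 < M" for M :: nat
  proof -
    obtain h k where hk: "0 < k" "k \<le> int M" "\<bar>of_int k * z - of_int h\<bar> < 1 / M"
      using Dirichlet_approx[OF M0] by blast
    have k: "1 \<le> real_of_int k" "real_of_int k \<le> real M" using hk by linarith+
    have "real M powr (- m) \<le> k powr (- m)" using k by (intro powr_mono2') (auto simp: m_def)
    also have "\<dots> \<le> k powr (1 - b)" using k by (intro powr_mono) (auto simp: m_def)
    finally have "c * real M powr (- m) \<le> c * k powr (1 - b)" using c(1) by simp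
    also have "\<dots> < 1 / M" using c(2)[of k h] hk by linarith
    finally have "c * real M powr (- m) * real M powr m < 1 / M * real M powr m"
      using M0 by (intro mult_strict_right_mono) auto
    then show ?thesis using M0 by (simp add: powr_diff powr_minus field_simps)
  qed
  have "((\<lambda>M. real M powr (m - 1)) \<longlongrightarrow> 0) sequentially"
    using m by (intro tendsto_neg_powr filterlim_real_sequentially) auto
  then have "\<forall>\<^sub>F M in sequentially. real M powr (m - 1) < c" using c(1) by (rule order_tendstoD)
  then obtain M where "0 < M" "real M powr (m - 1) < c"
    unfolding eventually_sequentially by (metis le_add1 le_add2 less_numeral_extra(1) order_less_le_trans)
  then show False using ge[of M] by linarith
qed

lemma diophantine_minus:
  assumes "diophantine (ereal b) (z::real)" shows "diophantine (ereal b) (- z)"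
proof -
  obtain c where c: "0 < c" "\<And>(p::int) (q::int). (1::int) \<le> q \<Longrightarrow> c * q powr (1 - b) \<le> \<bar>real_of_int q * z - real_of_int p\<bar>"
    using assms unfolding diophantine_real by blast
  have "c * q powr (1 - b) \<le> \<bar>real_of_int q * - z - real_of_int p\<bar>" if "(1::int) \<le> q" for p q :: int
    using c(2)[OF that, of "- p"] by (simp add: abs_minus_commute)
  with c(1) show ?thesis unfolding diophantine_real by blast
qed

lemma diophantine_add_1:
  assumes "diophantine (ereal b) (z::real)" shows "diophantine (ereal b) (z + 1)"
proof -
  obtain c where c: "0 < c" "\<And>(p::int) (q::int). (1::int) \<le> q \<Longrightarrow> c * q powr (1 - b) \<le> \<bar>real_of_int q * z - real_of_int p\<bar>"
    using assms unfolding diophantine_real by blast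
  have "c * q powr (1 - b) \<le> \<bar>real_of_int q * (z + 1) - real_of_int p\<bar>" if "(1::int) \<le> q" for p q :: int
    using c(2)[OF that, of "p - q"] by (simp add: algebra_simps)
  with c(1) show ?thesis unfolding diophantine_real by blast
qed

text \<open>\<open>q / z - p\<close> is \<open>p * z - q\<close> up to the factor
  \<open>- 1 / z\<close>, so the hypothesis applies with denominator \<open>p\<close>. Only those
  \<open>p\<close> within distance 1 of \<open>q / z\<close> matter, and they are at most a constant
  times \<open>q\<close>, which keeps the exponent.\<close>

lemma diophantine_inverse:
  assumes dio: "diophantine (ereal b) (z::real)" shows "diophantine (ereal b) (1 / z)"
proof -
  obtain c where c: "0 < c" "\<And>(p::int) (q::int). (1::int) \<le> q \<Longrightarrow> c * q powr (1 - b) \<le> \<bar>real_of_int q * z - real_of_int p\<bar>"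
    using dio unfolding diophantine_real by blast
  have b: "2 \<le> b" using diophantine_ge_2[OF dio] .
  have z: "z \<noteq> 0" using diophantine_irrational[OF dio] by auto
  define K where "K = 1 / \<bar>z\<bar> + 1"
  \<comment> \<open>The entries 1 and \<open>1 / \<bar>z\<bar>\<close> serve the \<open>p\<close> at
    distance at least 1 and \<open>p = 0\<close>; the last entry is the constant from the swap of
    \<open>p\<close> and \<open>q\<close>.\<close>
  define c' where "c' = min (min 1 (1 / \<bar>z\<bar>)) (c * K powr (1 - b) / \<bar>z\<bar>)"
  have K: "1 < K" using z by (simp add: K_def)
  have "c' * q powr (1 - b) \<le> \<bar>real_of_int q * (1 / z) - real_of_int p\<bar>" if q: "(1::int) \<le> q" for p q :: int
  proof -
    have qb: "real_of_int q powr (1 - b) \<le> 1" using q b powr_mono[of "1 - b" 0 "real_of_int q"] by simp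
    have triv: "c' * q powr (1 - b) \<le> m" if "1 \<le> m \<or> 1 / \<bar>z\<bar> \<le> m" for m
    proof -
      have "c' * q powr (1 - b) \<le> min 1 (1 / \<bar>z\<bar>) * 1"
        using qb by (intro mult_mono) (auto simp: c'_def)
      then show ?thesis using that by linarith
    qed
    show ?thesis
    proof (cases "p = 0 \<or> 1 \<le> \<bar>real_of_int q * (1 / z) - real_of_int p\<bar>")
      case True
      moreover have "1 / \<bar>z\<bar> \<le> \<bar>q * (1 / z)\<bar>" using q by (simp add: abs_mult divide_right_mono)
      ultimately show ?thesis by (intro triv) auto
    next
      case False
      have "\<bar>real_of_int p\<bar> \<le> \<bar>q * (1 / z)\<bar> + 1" using False by linarith
      also have "\<dots> \<le> K * q" using q by (simp add: K_def abs_mult algebra_simps)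
      finally have pK: "\<bar>real_of_int p\<bar> \<le> K * q" .
      have p1: "(1::int) \<le> \<bar>p\<bar>" using False by linarith
      have "(K * q) powr (1 - b) \<le> \<bar>p\<bar> powr (1 - b)" using pK p1 b by (intro powr_mono2') auto
      then have "c * (K powr (1 - b) * q powr (1 - b)) \<le> c * \<bar>p\<bar> powr (1 - b)"
        using c(1) K q by (simp add: powr_mult)
      also have "\<dots> \<le> \<bar>\<bar>p\<bar> * z - sgn p * q\<bar>" using c(2)[OF p1, of "sgn p * q"] by simp
      also have "\<dots> = \<bar>p * z - q\<bar>"
        using p1 by (cases p "0::int" rule: linorder_cases) (auto simp: abs_minus_commute)
      also have "\<dots> = \<bar>z\<bar> * \<bar>real_of_int q * (1 / z) - real_of_int p\<bar>" using z by (simp add: field_simps flip: abs_mult)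
      finally have "c * K powr (1 - b) / \<bar>z\<bar> * q powr (1 - b) \<le> \<bar>real_of_int q * (1 / z) - real_of_int p\<bar>"
        using z by (simp add: field_simps)
      moreover have "c' * q powr (1 - b) \<le> c * K powr (1 - b) / \<bar>z\<bar> * q powr (1 - b)"
        by (intro mult_right_mono) (auto simp: c'_def)
      ultimately show ?thesis by linarith
    qed
  qed
  moreover have "0 < c'" using z c(1) K by (simp add: c'_def)
  ultimately show ?thesis unfolding diophantine_real by blast
qed

text \<open>All four candidates arise from the slope by inversion, change of sign and adding 1,
  which preserve the exponent. Irrationality keeps the slope off -1, 0 and 1, so exactly one
  candidate lies in the unit interval and the definite description is meaningful.\<close>

lemma slope_rep_diophantine:
  assumes u1: "u$1 \<noteq> 0" and dio: "diophantine (ereal b) (u$2 / u$1)"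
  shows "diophantine (ereal b) (slope_rep u)" "0 < slope_rep u" "slope_rep u < 1"
proof -
  define s where "s = u$2 / u$1"
  have s: "s \<notin> \<rat>" using diophantine_irrational[OF dio] by (simp add: s_def)
  then have s01: "s \<noteq> 0" "s \<noteq> 1" "s \<noteq> - 1" by auto
  define S where "S = {1 / s, 1 / s + 1, - s, - s + 1}"
  have "slope_rep u = (THE z. z \<in> {0..<1} \<inter> S)" by (simp add: slope_rep_def S_def s_def)
  moreover have "\<exists>!z. z \<in> {0..<1} \<inter> S"
  proof -
    consider "1 < s" | "0 < s" "s < 1" | "s < 0" "- 1 < s" | "s < -1" using s01 by linarith
    then have "{0..<1} \<inter> S = {1 / s} \<or> {0..<1} \<inter> S = {- s + 1} \<or> {0..<1} \<inter> S = {- s} \<or> {0..<1} \<inter> S = {1 / s + 1}"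
    proof cases
      case 1 then have "{0..<1} \<inter> S = {1 / s}" unfolding S_def by (auto simp: field_simps)
      then show ?thesis by simp
    next
      case 2 then have "{0..<1} \<inter> S = {- s + 1}" unfolding S_def by (auto simp: field_simps)
      then show ?thesis by simp
    next
      case 3 then have "{0..<1} \<inter> S = {- s}" unfolding S_def by (auto simp: field_simps)
      then show ?thesis by simp
    next
      case 4 then have "{0..<1} \<inter> S = {1 / s + 1}" unfolding S_def by (auto simp: field_simps)
      then show ?thesis by simp
    qed
    then obtain t where "{0..<1} \<inter> S = {t}" by blast
    then show ?thesis by simp
  qed
  ultimately have z: "slope_rep u \<in> {0..<1} \<inter> S" by (metis (no_types, lifting) theI')
  note d = dio[folded s_def]
  show D: "diophantine (ereal b) (slope_rep u)"
    using z diophantine_inverse[OF d] diophantine_add_1[OF diophantine_inverse[OF d]]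
      diophantine_minus[OF d] diophantine_add_1[OF diophantine_minus[OF d]]
    by (auto simp: S_def)
  show "0 < slope_rep u" "slope_rep u < 1"
    using z diophantine_irrational[OF D] by (auto simp: order_less_le)
qed

text \<open>A digit is at most the quotient of two successive denominators. The diophantine
  condition bounds the later one by a power of the earlier, the time window bounds their product by
  \<open>exp \<tau>2\<close>, and the two bounds are interpolated. The start \<open>\<tau>0\<close>
  makes the window nonempty, so that the fallback value \<open>exp \<tau>2\<close> does not
  occur.\<close>

lemma xi_real_bound:
  assumes dio: "diophantine (ereal b) (z::real)" and z: "0 < z" "z < 1"
  obtains C \<tau>0 where "0 < C"
    "\<And>\<tau>1 \<tau>2. \<tau>1 \<le> \<tau>2 \<Longrightarrow> \<tau>0 \<le> \<tau>2 \<Longrightarrow>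
       1 \<le> xi_real z \<tau>1 \<tau>2 \<and> xi_real z \<tau>1 \<tau>2 \<le> C * exp \<tau>2 powr (1 - 2 / b)"
proof -
  have irr: "z \<notin> \<rat>" and b: "2 \<le> b" using diophantine_irrational diophantine_ge_2 dio by auto
  note zz = irr z
  obtain c where c: "0 < c" "\<And>(p::int) (q::int). (1::int) \<le> q \<Longrightarrow> c * q powr (1 - b) \<le> \<bar>real_of_int q * z - real_of_int p\<bar>"
    using dio unfolding diophantine_real by blast
  have digit: "cf_digit z (Suc j) \<le> (1 / c) powr (2 / b) * exp \<tau> powr (1 - 2 / b)"
    if t: "cf_time z j \<le> ereal \<tau>" for j \<tau>
  proof -
    define x y where "x = real_of_int (cf_den z j)" and "y = real_of_int (cf_den z (Suc j))"
    have x: "1 \<le> x" "1 \<le> y" using cf_den_ge_1[OF zz] by (simp_all add: x_def y_def)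
    have "ereal (ln (x * y)) \<le> ereal \<tau>"
      using order_trans[OF cf_time_ge[OF zz] t] by (simp add: x_def y_def)
    then have xy: "x * y \<le> exp \<tau>" using x by (simp add: ln_le_iff_le_exp)
    have "c * x powr (1 - b) \<le> \<bar>x * z - cf_num z j\<bar>"
      using c(2)[of "cf_den z j" "cf_num z j"] cf_den_ge_1[OF zz] by (simp add: x_def)
    also have "\<dots> = x * \<bar>z - cf_num z j / x\<bar>"
      using x by (subst abs_of_pos[of x, symmetric]) (auto simp: field_simps simp flip: abs_mult)
    also have "\<dots> \<le> x * (1 / (x * y))"
      using cf_error_le[OF zz, of j] x by (intro mult_left_mono) (auto simp: x_def y_def)
    finally have "c * x powr (1 - b) * y \<le> 1" using x by (simp add: field_simps)
    then have A: "y * x powr (1 - b) \<le> 1 / c" using c(1) by (simp add: field_simps)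
    have "real_of_int (cf_digit z (Suc j)) * x \<le> y"
      using cf_digit_mult_den_le[OF zz, of j] unfolding x_def y_def of_int_mult[symmetric] of_int_le_iff .
    then have "cf_digit z (Suc j) \<le> y / x" using x by (simp add: field_simps)
    \<comment> \<open>Raising the two bounded quantities to \<open>2 / b\<close> and
      \<open>1 - 2 / b\<close> makes the exponents of \<open>y\<close> add up to 1 and those of
      \<open>x\<close> to -1.\<close>
    also have "y / x = (y * x powr (1 - b)) powr (2 / b) * (x * y) powr (1 - 2 / b)"
    proof -
      have "(1 - b) * (2 / b) + (1 - 2 / b) = - 1" using b by (simp add: field_simps)
      then have "x powr ((1 - b) * (2 / b)) * x powr (1 - 2 / b) = inverse x"
        unfolding powr_add[symmetric] using x by (simp only: powr_minus powr_one)
      moreover have "y powr (2 / b) * y powr (1 - 2 / b) = y" using x by (simp flip: powr_add)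
      moreover have "(y * x powr (1 - b)) powr (2 / b) * (x * y) powr (1 - 2 / b)
        = (y powr (2 / b) * y powr (1 - 2 / b)) * (x powr ((1 - b) * (2 / b)) * x powr (1 - 2 / b))"
        using x by (simp only: powr_mult powr_powr powr_ge_zero mult_ac) 
      ultimately show ?thesis by (simp add: divide_inverse)
    qed
    also have "\<dots> \<le> (1 / c) powr (2 / b) * exp \<tau> powr (1 - 2 / b)"
      using A xy x b by (intro mult_mono powr_mono2) auto
    finally show ?thesis .
  qed
  define \<tau>0 where "\<tau>0 = real_of_ereal (cf_time z 0)"
  have t0: "cf_time z 0 = ereal \<tau>0" using irr by (simp add: \<tau>0_def cf_time_def)
  show ?thesis
  proof
    show "0 < (1 / c) powr (2 / b)" using c(1) by simp
    fix \<tau>1 \<tau>2 :: real assume t: "\<tau>1 \<le> \<tau>2" "\<tau>0 \<le> \<tau>2"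
    define I where "I = {k. 1 \<le> k \<and> cf_time z (k - 1) \<le> ereal \<tau>2}"
    define A where "A = {real_of_int (cf_digit z k) | k.
                 k \<in> cf_index z \<and> ereal \<tau>1 \<le> cf_time z (k + 1) \<and> cf_time z (k - 1) \<le> ereal \<tau>2}"
    have finI: "finite I" unfolding I_def by (rule cf_window_finite[OF zz])
    have AI: "A \<subseteq> (\<lambda>k. real_of_int (cf_digit z k)) ` I" unfolding A_def I_def cf_index_def by auto
    then have finA: "finite A" using finI finite_surj by blast
    have "1 \<in> I" using t t0 by (simp add: I_def)
    then have mx: "Max I \<in> I" using finI by (intro Max_in) auto
    \<comment> \<open>Maximality at \<open>Max I + 2\<close> rather than \<open>Max I + 1\<close> gives the bound on the time \<open>t\<close> of index
      \<open>Max I + 1\<close> without monotonicity of the times.\<close>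
    have "Max I + 2 \<notin> I" using Max_ge[OF finI, of "Max I + 2"] by auto
    then have "ereal \<tau>2 < cf_time z (Max I + 1)" by (simp add: I_def)
    then have "ereal \<tau>1 \<le> cf_time z (Max I + 1)" using t(1) by (meson ereal_less_eq(3) less_imp_le order_trans)
    then have "real_of_int (cf_digit z (Max I)) \<in> A"
      using mx irr unfolding A_def I_def cf_index_def by auto
    then have ne: "A \<noteq> {}" by auto
    have "xi_window z \<tau>1 \<tau>2 = (if A = {} then exp \<tau>2 else Max A)"
      by (simp only: xi_window_def A_def Let_def)
    then have "xi_real z \<tau>1 \<tau>2 = Max A" using irr ne by (simp add: xi_real_def)
    moreover have "Max A \<in> A" using finA ne by (rule Max_in)
    then obtain k where k: "Max A = cf_digit z k" "k \<in> I" using AI by auto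
    ultimately show "1 \<le> xi_real z \<tau>1 \<tau>2 \<and> xi_real z \<tau>1 \<tau>2 \<le> (1 / c) powr (2 / b) * exp \<tau>2 powr (1 - 2 / b)"
      using digit[of "k - 1" \<tau>2] cf_digit_ge_1[OF zz, of k] by (simp add: I_def)
  qed
qed

lemma xi_hat_bound:
  assumes u1: "u$1 \<noteq> 0" and dio: "diophantine (ereal b) (u$2 / u$1)"
  obtains C \<tau>0 where "0 < C"
    "\<And>\<tau>1 \<tau>2. \<tau>1 \<le> \<tau>2 \<Longrightarrow> \<tau>0 \<le> \<tau>2 \<Longrightarrow>
       1 \<le> xi_hat u \<tau>1 \<tau>2 \<and> xi_hat u \<tau>1 \<tau>2 \<le> C * exp \<tau>2 powr (1 - 2 / b)"
  using xi_real_bound[OF slope_rep_diophantine[OF u1 dio]] unfolding xi_hat_def by metis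

section \<open>Lipschitz test functions\<close>

text \<open>A maximum of tents, not a sum: height and Lipschitz constant stay those of a single tent
  however many tents overlap. The inserted 0 cuts the tents off.\<close>

definition bump :: "(real^2) set \<Rightarrow> real \<Rightarrow> real^2 \<Rightarrow> real" where
  "bump P \<epsilon> x = Max (insert 0 ((\<lambda>p. \<epsilon> - maxnorm (x - p)) ` P))"

text \<open>As \<open>\<epsilon>\<close> is at most half the inner radius, the support stays between
  \<open>\<rho>1 / 2\<close> and \<open>2 * \<rho>2\<close>. Bounds in these two radii alone are
  uniform in \<open>P\<close> and \<open>\<epsilon>\<close>, which will vary with
  \<open>T\<close>.\<close>

locale bump_function =
  fixes P :: "(real^2) set" and \<epsilon> \<rho>1 \<rho>2 :: real
  assumes fin: "finite P" and ne: "P \<noteq> {}" and eps: "0 < \<epsilon>" "\<epsilon> \<le> \<rho>1 / 2"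
    and annulus: "\<And>p. p \<in> P \<Longrightarrow> \<rho>1 \<le> maxnorm p \<and> maxnorm p \<le> \<rho>2"
begin

abbreviation "f \<equiv> bump P \<epsilon>"

lemma nonneg: "0 \<le> f x"
  unfolding bump_def using fin by simp

lemma ge: "p \<in> P \<Longrightarrow> \<epsilon> - maxnorm (x - p) \<le> f x"
  unfolding bump_def using fin by simp

lemma at_center: "p \<in> P \<Longrightarrow> \<epsilon> \<le> f p"
  using ge[of p p] by simp

lemma near_center:
  assumes "0 < f x" obtains p where "p \<in> P" "maxnorm (x - p) < \<epsilon>" "f x \<le> \<epsilon> - maxnorm (x - p)"
proof -
  have "f x \<in> insert 0 ((\<lambda>p. \<epsilon> - maxnorm (x - p)) ` P)" unfolding bump_def using fin by (intro Max_in) auto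
  then show ?thesis using assms that by auto
qed

lemma le_eps: "f x \<le> \<epsilon>"
proof (cases "0 < f x")
  case True
  then obtain p where "f x \<le> \<epsilon> - maxnorm (x - p)" by (rule near_center)
  then show ?thesis using maxnorm_nonneg[of "x - p"] by linarith
qed (use eps in linarith)

lemma lipschitz: "\<bar>f x - f y\<bar> \<le> maxnorm (x - y)"
proof -
  have "f x \<le> f y + maxnorm (x - y)" for x y
  proof (cases "0 < f x")
    case True
    then obtain p where p: "p \<in> P" "f x \<le> \<epsilon> - maxnorm (x - p)" by (rule near_center)
    then show ?thesis using ge[OF p(1), of y] maxnorm_triangle_diff[of y p x] maxnorm_minus_commute[of x y] by linarith
  next
    case False then show ?thesis using nonneg[of y] maxnorm_nonneg[of "x - y"] by linarith
  qed
  from this[of x y] this[of y x] show ?thesis by (simp add: abs_le_iff maxnorm_minus_commute)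
qed

lemma continuous: "continuous_on S f"
proof -
  have "1-lipschitz_on S f"
    using lipschitz maxnorm_le_norm by (intro lipschitz_onI) (auto simp: dist_norm intro: order_trans)
  then show ?thesis by (rule lipschitz_on_continuous_on)
qed

lemma measurable [measurable]: "f \<in> borel_measurable borel"
  by (intro borel_measurable_continuous_onI continuous)

lemma rho: "0 < \<rho>1" "\<rho>1 \<le> \<rho>2"
  using eps annulus ne by force+

lemma nonzero: assumes "f x \<noteq> 0" shows "\<rho>1 / 2 \<le> maxnorm x" "maxnorm x \<le> 2 * \<rho>2"
proof -
  have "0 < f x" using assms nonneg[of x] by simp
  then obtain p where p: "p \<in> P" "maxnorm (x - p) < \<epsilon>" by (rule near_center)
  show "\<rho>1 / 2 \<le> maxnorm x"
    using p annulus[OF p(1)] eps maxnorm_diff_ge[of p x] maxnorm_minus_commute[of p x] by linarith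
  show "maxnorm x \<le> 2 * \<rho>2" using p annulus[OF p(1)] eps maxnorm_diff_ge[of x p] by linarith
qed

lemma supp_subset: "supp f \<subseteq> {x. \<rho>1 / 2 \<le> maxnorm x \<and> maxnorm x \<le> 2 * \<rho>2}"
  unfolding supp_def
proof (rule closure_minimal)
  show "closed {x::real^2. \<rho>1 / 2 \<le> maxnorm x \<and> maxnorm x \<le> 2 * \<rho>2}"
    by (intro closed_Collect_conj closed_Collect_le continuous_intros)
qed (use nonzero in auto)

lemma P_subset_supp: "P \<subseteq> supp f"
proof
  fix p assume "p \<in> P"
  then have "f p \<noteq> 0" using at_center eps by fastforce
  then show "p \<in> supp f" unfolding supp_def by (intro subsetD[OF closure_subset]) simp
qed

lemma radii:
  "\<rho>1 \<le> outer_radius f" "outer_radius f \<le> 2 * \<rho>2"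
  "\<rho>1 / 2 \<le> inner_radius f" "inner_radius f \<le> outer_radius f"
proof -
  obtain p where p: "p \<in> P" using ne by auto
  then have ps: "p \<in> supp f" using P_subset_supp by auto
  have bdd: "bdd_above (maxnorm ` supp f)" "bdd_below (maxnorm ` supp f)"
    using supp_subset by (auto intro!: bdd_aboveI[of _ "2 * \<rho>2"] bdd_belowI[of _ 0])
  have "maxnorm p \<le> outer_radius f" unfolding outer_radius_def by (intro cSUP_upper ps bdd)
  then show "\<rho>1 \<le> outer_radius f" using annulus[OF p] by linarith
  have "inner_radius f \<le> maxnorm p" unfolding inner_radius_def by (intro cINF_lower ps bdd)
  then show "inner_radius f \<le> outer_radius f" using \<open>maxnorm p \<le> outer_radius f\<close> by linarith
  show "outer_radius f \<le> 2 * \<rho>2" unfolding outer_radius_def using ps supp_subset by (intro cSUP_least) auto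
  show "\<rho>1 / 2 \<le> inner_radius f" unfolding inner_radius_def using ps supp_subset by (intro cINF_greatest) auto
qed

end

lemma punctured_plane_measurable [measurable]: "punctured_plane \<in> sets borel"
  unfolding punctured_plane_def by measurable

lemma maxnorm_ball_eq_cbox: "{x. maxnorm (x - p) \<le> e} = cbox (p - (\<chi> i. e)) (p + (\<chi> i. e))"
  by (auto simp: maxnorm_le_iff mem_box_cart forall_2 abs_le_iff)

lemma maxnorm_ball_measure:
  assumes "0 \<le> e" shows "{x. maxnorm (x - p) \<le> e} \<in> sets lborel"
    "measure lborel {x. maxnorm (x - p) \<le> e} = 4 * e\<^sup>2" "emeasure lborel {x. maxnorm (x - p) \<le> e} < \<infinity>"
proof -
  show "{x. maxnorm (x - p) \<le> e} \<in> sets lborel" "emeasure lborel {x. maxnorm (x - p) \<le> e} < \<infinity>"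
    unfolding maxnorm_ball_eq_cbox using emeasure_lborel_cbox_finite by auto
  show "measure lborel {x. maxnorm (x - p) \<le> e} = 4 * e\<^sup>2"
    unfolding maxnorm_ball_eq_cbox using assms
    by (subst content_cbox_cart) (auto simp: interval_ne_empty_cart prod_constant UNIV_2 power2_eq_square)
qed

context bump_function
begin

text \<open>The summands bound the supremum, the weighted square integral and the Hoelder quotient;
  \<open>16 * \<rho>2\<^sup>2\<close> is the area of a square containing the support, and
  \<open>f x\<close> never exceeds \<open>maxnorm x\<close>.\<close>

definition holder_bound :: real where
  "holder_bound = \<rho>1 + sqrt (16 * \<rho>2\<^sup>2) + 4 * \<rho>2"

lemma holder_norm_le: "holder_norm 1 f \<le> ereal holder_bound"
proof -
  have pp: "x \<in> punctured_plane \<longleftrightarrow> 0 < maxnorm x" for x by (simp add: punctured_plane_def maxnorm_pos_iff)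
  have "(SUP x\<in>punctured_plane. ereal \<bar>f x\<bar>) \<le> ereal \<rho>1"
  proof (rule SUP_least)
    show "ereal \<bar>f x\<bar> \<le> ereal \<rho>1" for x using nonneg[of x] le_eps[of x] eps rho by simp
  qed
  moreover have "(LINT x:punctured_plane|lborel. (f x)^2 / (maxnorm x)^2) \<le> 16 * \<rho>2\<^sup>2"
  proof -
    let ?B = "{x::real^2. maxnorm (x - 0) \<le> 2 * \<rho>2}"
    have "(LINT x:punctured_plane|lborel. (f x)^2 / (maxnorm x)^2) \<le> (LINT x|lborel. indicator ?B x)"
      unfolding set_lebesgue_integral_def
    proof (rule integral_mono')
      show "integrable lborel (indicator ?B :: real^2 \<Rightarrow> real)"
        using maxnorm_ball_measure[of "2 * \<rho>2" 0] rho by simp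
      show "0 \<le> (indicator ?B x::real)" for x by simp
      show "indicator punctured_plane x *\<^sub>R ((f x)^2 / (maxnorm x)^2) \<le> (indicator ?B x::real)" for x
      proof (cases "f x = 0")
        case False
        have "(f x)^2 \<le> (maxnorm x)^2"
          using nonneg[of x] le_eps[of x] eps nonzero(1)[OF False] by (intro power_mono) auto
        then have "(f x)^2 / (maxnorm x)^2 \<le> 1" using nonzero(1)[OF False] rho by (simp add: divide_le_eq)
        then show ?thesis using nonzero(2)[OF False] by (auto simp: indicator_def)
      qed simp
    qed
    also have "\<dots> = 16 * \<rho>2\<^sup>2" using maxnorm_ball_measure(1,2)[of "2 * \<rho>2" 0] rho by simp
    finally show ?thesis .
  qed
  then have "ereal (sqrt (LINT x:punctured_plane|lborel. (f x)^2 / (maxnorm x)^2)) \<le> ereal (sqrt (16 * \<rho>2\<^sup>2))"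
    by simp
  moreover have "(SUP (x, y)\<in>{(x, y). 0 < maxnorm (x - y) \<and> maxnorm (x - y) \<le> maxnorm x / 2}.
          ereal (maxnorm x powr 1 * \<bar>f x - f y\<bar> / maxnorm (x - y) powr 1)) \<le> ereal (4 * \<rho>2)"
  proof (rule SUP_least, clarify)
    fix x y :: "real^2" assume xy: "0 < maxnorm (x - y)" "maxnorm (x - y) \<le> maxnorm x / 2"
    have "maxnorm x * \<bar>f x - f y\<bar> \<le> 4 * \<rho>2 * maxnorm (x - y)"
    proof (cases "maxnorm x \<le> 4 * \<rho>2")
      case True then show ?thesis using lipschitz[of x y] rho by (intro mult_mono) auto
    next
      case False
      \<comment> \<open>Admissible pairs differ by at most half of \<open>maxnorm x\<close>, so far
        from the origin both points lie outside the support.\<close>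
      then have "2 * \<rho>2 < maxnorm y" "2 * \<rho>2 < maxnorm x" using xy maxnorm_diff_ge[of x y] rho by linarith+
      then have "f x = 0" "f y = 0" using nonzero(2)[of x] nonzero(2)[of y] by linarith+
      then show ?thesis using rho by simp
    qed
    then show "ereal (maxnorm x powr 1 * \<bar>f x - f y\<bar> / maxnorm (x - y) powr 1) \<le> ereal (4 * \<rho>2)"
      using xy by (simp add: field_simps)
  qed
  ultimately have "holder_norm 1 f \<le> ereal \<rho>1 + ereal (sqrt (16 * \<rho>2\<^sup>2)) + ereal (4 * \<rho>2)"
    unfolding holder_norm_def by (intro add_mono)
  then show ?thesis by (simp add: holder_bound_def)
qed

text \<open>Nonnegativity secures monotonicity of \<open>real_of_ereal\<close>, which sends infinite
  values to 0. A point and an admissible pair are exhibited because a supremum over the empty set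
  would be minus infinity.\<close>

lemma holder_norm_real: "0 \<le> real_of_ereal (holder_norm 1 f)" "real_of_ereal (holder_norm 1 f) \<le> holder_bound"
proof -
  have e1: "vector [1, 1] \<in> punctured_plane" by (simp add: punctured_plane_def vec_eq_iff forall_2)
  have "0 \<le> (SUP x\<in>punctured_plane. ereal \<bar>f x\<bar>)" by (rule SUP_upper2[OF e1]) simp
  moreover have "(0::ereal) \<le> (SUP (x, y)\<in>{(x, y). 0 < maxnorm (x - y) \<and> maxnorm (x - y) \<le> maxnorm x / 2}.
          ereal (maxnorm x powr 1 * \<bar>f x - f y\<bar> / maxnorm (x - y) powr 1))"
    by (rule SUP_upper2[of "(vector [2, 2], vector [1, 1])"]) (auto simp: maxnorm_def)
  moreover have "0 \<le> (LINT x:punctured_plane|lborel. (f x)^2 / (maxnorm x)^2)"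
    unfolding set_lebesgue_integral_def by (intro Bochner_Integration.integral_nonneg) simp
  ultimately have nn: "0 \<le> holder_norm 1 f" unfolding holder_norm_def by (intro add_nonneg_nonneg) auto
  then show "0 \<le> real_of_ereal (holder_norm 1 f)" by (rule real_of_ereal_pos)
  show "real_of_ereal (holder_norm 1 f) \<le> holder_bound"
    using real_of_ereal_positive_mono[OF nn holder_norm_le] by simp
qed

lemma holder: "holder 1 f"
proof -
  have sub: "supp f \<subseteq> cbox (0 - (\<chi> i. 2 * \<rho>2)) (0 + (\<chi> i. 2 * \<rho>2))"
    unfolding maxnorm_ball_eq_cbox[symmetric] using supp_subset by auto
  then have "compact (supp f)"
    unfolding compact_eq_bounded_closed by (auto simp: supp_def intro: bounded_subset[OF bounded_cbox])
  moreover have "supp f \<subseteq> punctured_plane" using supp_subset rho by (auto simp: punctured_plane_def)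
  moreover have "holder_norm 1 f < \<infinity>" using holder_norm_le by (auto intro: le_less_trans)
  ultimately show ?thesis using continuous by (simp add: holder_def)
qed

text \<open>From above, the integrand is dominated by boxes of side \<open>2 * \<epsilon>\<close>
  around the centres; from below, a single tent is at least \<open>\<epsilon> / 2\<close> on the box
  of half the size. Height times area gives the cube, as \<open>star\<close> lies between positive
  constants on the support.\<close>

lemma integral_bounds:
  assumes N: "matrix_norm N" and u: "u \<noteq> 0"
    and l: "0 < l" "\<And>v. l * maxnorm v \<le> star N v u"
    and L: "0 < L" "\<And>v. star N v u \<le> L * maxnorm v"
  shows "(LINT v:punctured_plane|lborel. f v / star N v u) \<le> 8 / (l * \<rho>1) * real (card P) * \<epsilon>^3"
    and "\<epsilon>^3 / (4 * L * \<rho>2) \<le> (LINT v:punctured_plane|lborel. f v / star N v u)"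
proof -
  let ?g = "\<lambda>v. indicator punctured_plane v *\<^sub>R (f v / star N v u)"
  let ?h = "\<lambda>v. \<Sum>p\<in>P. 2 * \<epsilon> / (l * \<rho>1) * indicator {x. maxnorm (x - p) \<le> \<epsilon>} v"
  have [measurable]: "(\<lambda>v. star N v u) \<in> borel_measurable borel"
    by (intro borel_measurable_continuous_onI continuous_star[OF N u])
  have star_nn: "0 \<le> star N v u" for v using l(2)[of v] l(1) maxnorm_nonneg[of v]
    by (meson mult_nonneg_nonneg less_imp_le order_trans)
  have g_nn: "0 \<le> ?g v" for v using nonneg star_nn by simp
  have h_nn: "0 \<le> ?h v" for v using l eps rho by (intro sum_nonneg) simp
  have gh: "?g v \<le> ?h v" for v
  proof (cases "f v = 0")
    case False
    then obtain p where p: "p \<in> P" "maxnorm (v - p) < \<epsilon>" using nonneg[of v] near_center[of v] by (metis order_less_le)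
    have "l * (\<rho>1 / 2) \<le> star N v u"
      using order_trans[OF mult_left_mono[OF nonzero(1)[OF False]] l(2)[of v]] l(1) by simp
    then have "f v / star N v u \<le> \<epsilon> / (l * (\<rho>1 / 2))"
      using le_eps[of v] nonneg[of v] l(1) rho eps by (intro frac_le) auto
    then have "?g v \<le> 2 * \<epsilon> / (l * \<rho>1) * indicator {x. maxnorm (x - p) \<le> \<epsilon>} v"
      using p nonneg star_nn l rho eps by (auto simp: indicator_def field_simps)
    also have "\<dots> \<le> ?h v"
      using l eps rho p(1) by (intro member_le_sum fin) auto
    finally show ?thesis .
  qed (use h_nn[of v] in simp)
  have int_h: "integrable lborel ?h"
    using maxnorm_ball_measure(1,3)[of \<epsilon>] eps by (intro Bochner_Integration.integrable_sum integrable_mult_right) simp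
  have "(\<integral>v. ?g v \<partial>lborel) \<le> (\<integral>v. ?h v \<partial>lborel)"
    using int_h gh h_nn by (rule integral_mono')
  also have "\<dots> = (\<Sum>p\<in>P. 2 * \<epsilon> / (l * \<rho>1) * (4 * \<epsilon>\<^sup>2))"
    using maxnorm_ball_measure[of \<epsilon>] eps by (subst Bochner_Integration.integral_sum) auto
  also have "\<dots> = 8 / (l * \<rho>1) * real (card P) * \<epsilon>^3" by (simp add: power3_eq_cube power2_eq_square)
  finally show "(LINT v:punctured_plane|lborel. f v / star N v u) \<le> 8 / (l * \<rho>1) * real (card P) * \<epsilon>^3"
    unfolding set_lebesgue_integral_def .
  have int_g: "integrable lborel ?g"
    using int_h 
  proof (rule Bochner_Integration.integrable_bound)
    show "AE v in lborel. norm (?g v) \<le> norm (?h v)"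
    proof (rule AE_I2)
      show "norm (?g v) \<le> norm (?h v)" for v unfolding real_norm_def using g_nn[of v] h_nn[of v] gh[of v] by linarith
    qed
  qed measurable
  obtain p where p: "p \<in> P" using ne by auto
  let ?k = "\<lambda>v. \<epsilon> / 2 / (L * (2 * \<rho>2)) * indicator {x. maxnorm (x - p) \<le> \<epsilon> / 2} v"
  have kg: "?k v \<le> ?g v" for v
  proof (cases "maxnorm (v - p) \<le> \<epsilon> / 2")
    case True
    have fv: "\<epsilon> / 2 \<le> f v" using ge[OF p, of v] True by linarith
    then have nz: "f v \<noteq> 0" using eps by auto
    have v: "0 < maxnorm v" using nonzero(1)[OF nz] rho by simp
    have "star N v u \<le> L * (2 * \<rho>2)"
      using L order_trans[OF L(2)[of v] mult_left_mono[OF nonzero(2)[OF nz]]] by simp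
    moreover have "0 < star N v u" using l(2)[of v] l(1) v by (meson mult_pos_pos order_less_le_trans)
    ultimately have "\<epsilon> / 2 / (L * (2 * \<rho>2)) \<le> f v / star N v u"
      using fv nonneg by (intro frac_le) auto
    then show ?thesis using True v by (simp add: punctured_plane_def maxnorm_pos_iff)
  qed (use g_nn[of v] in simp)
  have "\<epsilon>^3 / (4 * L * \<rho>2) = (\<integral>v. ?k v \<partial>lborel)"
    using maxnorm_ball_measure(1,2)[of "\<epsilon> / 2" p] eps by (simp add: power3_eq_cube power2_eq_square field_simps)
  also have "\<dots> \<le> (\<integral>v. ?g v \<partial>lborel)" using int_g kg g_nn by (rule integral_mono')
  finally show "\<epsilon>^3 / (4 * L * \<rho>2) \<le> (LINT v:punctured_plane|lborel. f v / star N v u)"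
    unfolding set_lebesgue_integral_def .
qed

end

section \<open>The estimate for bumps in a fixed annulus\<close>

text \<open>The body under the quantifiers of \<open>equidistribution_exponent\<close>, named so
  that it can be specialised before its abbreviations are unfolded.\<close>

definition equidistribution_estimate ::
  "(real^2^2 \<Rightarrow> real) \<Rightarrow> real \<Rightarrow> real \<Rightarrow> real \<Rightarrow> real \<Rightarrow> real^2 \<Rightarrow> (real^2 \<Rightarrow> real) \<Rightarrow> real \<Rightarrow> bool" where
  "equidistribution_estimate N \<delta> \<theta> c C u f T \<longleftrightarrow>
     (let R = outer_radius f; r = inner_radius f;
          D0 = max (R / maxnorm u) (maxnorm u / r);
          B = (R / maxnorm u) powr (- \<theta> * \<delta>) * (ln (R / r) + 1);
          \<xi> = xi_hat u (ln (T * maxnorm u / R)) (ln (T * maxnorm u / r))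
      in T > c * D0 \<and> T \<ge> c * maxnorm u * \<xi> / R \<longrightarrow>
         \<bar>orbit_sum N f u T
           - 2 * T / covolume * (LINT v:punctured_plane|lborel. f v / star N v u)\<bar>
         \<le> C * real_of_ereal (holder_norm \<theta> f) * (R / maxnorm u)
            * (D0 + B * T powr (1 - \<theta> * \<delta>) * \<xi> powr (\<theta> * \<delta>)))"

lemma equidistribution_exponent_iff:
  "equidistribution_exponent N \<delta> \<longleftrightarrow> 0 < \<delta> \<and>
     (\<exists>c>0. \<forall>\<theta>. 0 < \<theta> \<and> \<theta> \<le> 1 \<longrightarrow> (\<exists>C>0. \<forall>u\<in>punctured_plane. \<forall>f. holder \<theta> f \<longrightarrow>
       (\<forall>T>0. equidistribution_estimate N \<delta> \<theta> c C u f T)))"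
  unfolding equidistribution_exponent_def equidistribution_estimate_def Let_def ..

text \<open>In a fixed annulus the radii, the Hoelder norm, \<open>D0\<close> and \<open>B\<close>
  are bounded, and only \<open>\<xi>\<close> can grow with \<open>T\<close>. Its bound of order
  \<open>T powr (1 - 2 / b)\<close> turns \<open>T powr (1 - \<delta>) * \<xi> powr \<delta>\<close>
  into \<open>T powr (1 - 2 * \<delta> / b)\<close>; the 1 stands for \<open>D0\<close>. The
  constants are fixed before \<open>P\<close> and \<open>\<epsilon>\<close>.\<close>

lemma bump_discrepancy:
  assumes equi: "equidistribution_exponent N \<delta>" and u1: "u$1 \<noteq> 0"
    and dio: "diophantine (ereal b) (u$2 / u$1)" and \<rho>: "0 < \<rho>1" "\<rho>1 \<le> \<rho>2"
  obtains C T0 where "0 < C" "1 \<le> T0"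
    "\<And>P \<epsilon> T. bump_function P \<epsilon> \<rho>1 \<rho>2 \<Longrightarrow> T0 \<le> T \<Longrightarrow>
       \<bar>orbit_sum N (bump P \<epsilon>) u T
         - 2 * T / covolume * (LINT v:punctured_plane|lborel. bump P \<epsilon> v / star N v u)\<bar>
       \<le> C * (1 + T powr (1 - 2 * \<delta> / b))"
proof -
  have b: "2 \<le> b" using diophantine_ge_2[OF dio] .
  have u: "u \<in> punctured_plane" using u1 by (auto simp: punctured_plane_def)
  then have w: "0 < maxnorm u" by (simp add: punctured_plane_def maxnorm_pos_iff)
  define w where "w = maxnorm u"
  have w: "0 < w" using w by (simp add: w_def)
  have d: "0 < \<delta>" using equi by (simp add: equidistribution_exponent_def)
  obtain Cx \<tau>0 where Cx: "0 < Cx" "\<And>\<tau>1 \<tau>2. \<tau>1 \<le> \<tau>2 \<Longrightarrow> \<tau>0 \<le> \<tau>2 \<Longrightarrow>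
       1 \<le> xi_hat u \<tau>1 \<tau>2 \<and> xi_hat u \<tau>1 \<tau>2 \<le> Cx * exp \<tau>2 powr (1 - 2 / b)"
    using xi_hat_bound[OF u1 dio] by metis
  obtain c C0 where c: "0 < c" "0 < C0"
    and E: "\<And>f T. holder 1 f \<Longrightarrow> 0 < T \<Longrightarrow> equidistribution_estimate N \<delta> 1 c C0 u f T"
    using equi u unfolding equidistribution_exponent_iff by (metis order_refl zero_less_one)
  define D where "D = max (2 * \<rho>2 / w) (2 * w / \<rho>1)"
  define K where "K = Cx * (2 * w / \<rho>1) powr (1 - 2 / b)"
  define B where "B = (\<rho>1 / w) powr (- \<delta>) * (ln (4 * \<rho>2 / \<rho>1) + 1)"
  define H where "H = \<rho>1 + sqrt (16 * \<rho>2\<^sup>2) + 4 * \<rho>2"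
  \<comment> \<open>One entry per requirement: \<open>1 \<le> T\<close>, the two side conditions of
    the estimate, and the range of \<open>\<tau>2\<close> in the bound on
    \<open>\<xi>\<close>.\<close>
  define T0 where "T0 = Max {1, c * D + 1, (c * w * K / \<rho>1) powr (b / 2), exp \<tau>0 * (2 * \<rho>2) / w}"
  define C where "C = C0 * H * (2 * \<rho>2 / w) * (D + B * K powr \<delta>)"
  have D: "0 < D" using w \<rho> by (simp add: D_def less_max_iff_disj)
  have K: "0 < K" using Cx w \<rho> by (simp add: K_def)
  have B: "0 < B" using w \<rho> by (auto simp: B_def intro!: mult_pos_pos add_nonneg_pos)
  have H: "0 < H" using \<rho> by (simp add: H_def add_pos_nonneg)
  have C: "0 < C" using c w \<rho> H D B K unfolding C_def by (intro mult_pos_pos add_pos_nonneg) auto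
  have main: "\<bar>orbit_sum N (bump P \<epsilon>) u T
         - 2 * T / covolume * (LINT v:punctured_plane|lborel. bump P \<epsilon> v / star N v u)\<bar>
       \<le> C * (1 + T powr (1 - 2 * \<delta> / b))"
    if bf: "bump_function P \<epsilon> \<rho>1 \<rho>2" and TT: "T0 \<le> T" for P \<epsilon> T
  proof -
    interpret bump_function P \<epsilon> \<rho>1 \<rho>2 by (rule bf)
    define R r where "R = outer_radius f" and "r = inner_radius f"
    define \<xi> where "\<xi> = xi_hat u (ln (T * w / R)) (ln (T * w / r))"
    have Rr: "\<rho>1 \<le> R" "R \<le> 2 * \<rho>2" "\<rho>1 / 2 \<le> r" "r \<le> R" "0 < r" "0 < R"
      using radii \<rho> by (auto simp: R_def r_def)
    have T: "1 \<le> T" "c * D + 1 \<le> T" "(c * w * K / \<rho>1) powr (b / 2) \<le> T" "exp \<tau>0 * (2 * \<rho>2) / w \<le> T"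
      using TT by (auto simp: T0_def)
    have le: "T * w / R \<le> T * w / r" using T w Rr by (intro divide_left_mono mult_pos_pos) auto
    have pos: "0 < T * w / R" "0 < T * w / r" using T w Rr by auto
    have "exp \<tau>0 * r \<le> exp \<tau>0 * (2 * \<rho>2)" using Rr by simp
    also have "\<dots> \<le> T * w" using T(4) w by (simp add: field_simps)
    finally have "exp \<tau>0 \<le> T * w / r" using Rr by (simp add: field_simps)
    then have "\<tau>0 \<le> ln (T * w / r)" using pos by (simp add: ln_ge_iff)
    moreover have "ln (T * w / R) \<le> ln (T * w / r)" using le pos by simp
    ultimately have "1 \<le> \<xi> \<and> \<xi> \<le> Cx * exp (ln (T * w / r)) powr (1 - 2 / b)"
      unfolding \<xi>_def by (intro Cx(2))
    then have x1: "1 \<le> \<xi>" and x2: "\<xi> \<le> Cx * (T * w / r) powr (1 - 2 / b)" using pos by auto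
    have "T * w / r \<le> T * w / (\<rho>1 / 2)"
      using T w Rr \<rho> by (intro divide_left_mono) auto
    also have "\<dots> = (2 * w / \<rho>1) * T" by simp
    finally have "(T * w / r) powr (1 - 2 / b) \<le> ((2 * w / \<rho>1) * T) powr (1 - 2 / b)"
      using pos b by (intro powr_mono2) auto
    also have "\<dots> = (2 * w / \<rho>1) powr (1 - 2 / b) * T powr (1 - 2 / b)"
      by (rule powr_mult)
    finally have "Cx * (T * w / r) powr (1 - 2 / b) \<le> K * T powr (1 - 2 / b)"
      using Cx(1) unfolding K_def by simp
    with x2 have x3: "\<xi> \<le> K * T powr (1 - 2 / b)" by linarith
    have D0: "max (R / w) (w / r) \<le> D"
    proof -
      have "R / w \<le> 2 * \<rho>2 / w" using Rr w by (intro divide_right_mono) auto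
      moreover have "w / r \<le> w / (\<rho>1 / 2)" using Rr w \<rho> by (intro divide_left_mono) auto
      ultimately show ?thesis unfolding D_def by (auto simp: mult.commute le_max_iff_disj)
    qed
    have "c * max (R / w) (w / r) \<le> c * D" using D0 c(1) by (rule mult_left_mono[OF _ less_imp_le])
    then have cond1: "c * max (R / w) (w / r) < T" using T(2) by linarith
    have "c * w * \<xi> / R \<le> c * w * (K * T powr (1 - 2 / b)) / \<rho>1"
      using x3 x1 c(1) w Rr \<rho> by (intro frac_le mult_left_mono) auto
    also have "\<dots> = (c * w * K / \<rho>1) * T powr (1 - 2 / b)" by simp
    \<comment> \<open>Written as a power with exponent \<open>2 / b\<close>, the constant is
      absorbed by the gap between \<open>T powr (1 - 2 / b)\<close> and \<open>T\<close>.\<close>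
    also have "c * w * K / \<rho>1 = ((c * w * K / \<rho>1) powr (b / 2)) powr (2 / b)"
      using c(1) w K \<rho> b by (simp add: powr_powr)
    also have "\<dots> \<le> T powr (2 / b)" using T(3) b by (intro powr_mono2) auto
    finally have cond2: "c * w * \<xi> / R \<le> T"
      using T(1) by (simp add: mult_right_mono flip: powr_add)
    have RB: "(R / w) powr (- \<delta>) \<le> (\<rho>1 / w) powr (- \<delta>)"
      using Rr w \<rho> d by (intro powr_mono2' divide_right_mono) auto
    have "R / r \<le> 2 * \<rho>2 / (\<rho>1 / 2)" using Rr \<rho> by (intro frac_le) auto
    also have "\<dots> = 4 * \<rho>2 / \<rho>1" by simp
    finally have "ln (R / r) \<le> ln (4 * \<rho>2 / \<rho>1)" using Rr \<rho> by (intro ln_mono) auto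
    moreover have "0 \<le> ln (R / r)" using Rr by simp
    ultimately have BB: "(R / w) powr (- \<delta>) * (ln (R / r) + 1) \<le> B" "0 \<le> (R / w) powr (- \<delta>) * (ln (R / r) + 1)"
      unfolding B_def using RB by (auto intro!: mult_mono)
    have "\<xi> powr \<delta> \<le> (K * T powr (1 - 2 / b)) powr \<delta>" using x1 x3 d by (intro powr_mono2) auto
    also have "\<dots> = K powr \<delta> * T powr (\<delta> - 2 * \<delta> / b)"
      using K T by (simp add: powr_mult powr_powr algebra_simps)
    finally have "T powr (1 - \<delta>) * \<xi> powr \<delta> \<le> T powr (1 - \<delta>) * (K powr \<delta> * T powr (\<delta> - 2 * \<delta> / b))"
      by (rule mult_left_mono) simp
    also have "\<dots> = K powr \<delta> * T powr (1 - 2 * \<delta> / b)" using T by (simp add: powr_add[symmetric])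
    finally have TX: "T powr (1 - \<delta>) * \<xi> powr \<delta> \<le> K powr \<delta> * T powr (1 - 2 * \<delta> / b)" .
    define Y where "Y = T powr (1 - 2 * \<delta> / b)"
    have Y: "0 \<le> Y" by (simp add: Y_def)
    have "max (R / w) (w / r) + (R / w) powr (- \<delta>) * (ln (R / r) + 1) * (T powr (1 - \<delta>) * \<xi> powr \<delta>)
       \<le> D + B * (K powr \<delta> * Y)"
      using BB B by (intro add_mono D0 mult_mono[OF BB(1) TX[folded Y_def]]) auto
    also have "\<dots> \<le> (D + B * K powr \<delta>) * (1 + Y)" using D B K Y by (simp add: algebra_simps)
    finally have Z: "max (R / w) (w / r) + (R / w) powr (- \<delta>) * (ln (R / r) + 1) * T powr (1 - \<delta>) * \<xi> powr \<delta>
       \<le> (D + B * K powr \<delta>) * (1 + Y)" by (simp add: mult.assoc)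
    have "\<bar>orbit_sum N f u T
                - 2 * T / covolume * (LINT v:punctured_plane|lborel. f v / star N v u)\<bar>
        \<le> C0 * real_of_ereal (holder_norm 1 f) * (R / w)
         * (max (R / w) (w / r) + (R / w) powr (- \<delta>) * (ln (R / r) + 1) * T powr (1 - \<delta>) * \<xi> powr \<delta>)"
      using E[OF holder, of T] cond1 cond2 T(1)
      unfolding equidistribution_estimate_def Let_def w_def[symmetric] R_def[symmetric] r_def[symmetric] \<xi>_def[symmetric]
      by simp
    also have "\<dots> \<le> C0 * H * (2 * \<rho>2 / w) * ((D + B * K powr \<delta>) * (1 + Y))"
      using holder_norm_real Z c(2) Rr w H BB
      by (intro mult_mono divide_right_mono mult_nonneg_nonneg add_nonneg_nonneg)
         (auto simp: H_def holder_bound_def le_max_iff_disj)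
    also have "\<dots> = C * (1 + Y)" by (simp add: C_def)
    finally show ?thesis unfolding Y_def .
  qed
  show ?thesis
  proof (rule that[OF C])
    show "1 \<le> T0" by (simp add: T0_def)
  qed (rule main)
qed

section \<open>Orbit points of a quadratic irrational direction\<close>

text \<open>The exponent of 2 is odd on the left and even on the right.\<close>

lemma twice_square_ne_square:
  fixes p q :: int assumes "q \<noteq> 0" shows "2 * q\<^sup>2 \<noteq> p\<^sup>2"
proof
  assume eq: "2 * q\<^sup>2 = p\<^sup>2"
  then have "p \<noteq> 0" using assms by auto
  have "prime_elem (2::int)" by (simp add: prime_imp_prime_elem)
  then have "multiplicity 2 (2 * q\<^sup>2) = 1 + 2 * multiplicity 2 q" "multiplicity 2 (p\<^sup>2) = 2 * multiplicity 2 p"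
    using assms \<open>p \<noteq> 0\<close> by (simp_all add: prime_elem_multiplicity_mult_distrib prime_elem_multiplicity_power_distrib)
  with eq show False by presburger
qed

text \<open>The product of \<open>q * sqrt 2 - p\<close> with its conjugate is a nonzero integer,
  and when the first factor is below 1 in absolute value the conjugate is at most
  \<open>4 * q\<close>.\<close>

lemma diophantine_sqrt_2: "diophantine (ereal 2) (sqrt 2)"
proof -
  have "1 / 4 * real_of_int q powr (1 - 2) \<le> \<bar>real_of_int q * sqrt 2 - real_of_int p\<bar>" if q: "(1::int) \<le> q" for p q :: int
  proof (cases "1 \<le> \<bar>real_of_int q * sqrt 2 - real_of_int p\<bar>")
    case True
    have "real_of_int q powr (1 - 2) \<le> 1" using q powr_mono[of "-1" 0 "real_of_int q"] by simp
    then show ?thesis using True by linarith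
  next
    case False
    have s: "sqrt 2 < 3 / 2" by (rule real_less_lsqrt) (auto simp: power2_eq_square)
    have "real_of_int q * sqrt 2 \<le> real_of_int q * (3 / 2)" "0 \<le> real_of_int q * sqrt 2"
      using s q by (auto intro!: mult_left_mono)
    then have "\<bar>real_of_int q * sqrt 2 + real_of_int p\<bar> \<le> 4 * real_of_int q" using False q by linarith
    then have "\<bar>real_of_int q * sqrt 2 - real_of_int p\<bar> * \<bar>real_of_int q * sqrt 2 + real_of_int p\<bar>
      \<le> \<bar>real_of_int q * sqrt 2 - real_of_int p\<bar> * (4 * real_of_int q)"
      by (intro mult_left_mono) auto
    moreover have "\<bar>real_of_int q * sqrt 2 - real_of_int p\<bar> * \<bar>real_of_int q * sqrt 2 + real_of_int p\<bar>
      = real_of_int \<bar>2 * q\<^sup>2 - p\<^sup>2\<bar>"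
      by (simp add: algebra_simps power2_eq_square flip: abs_mult)
    moreover have "1 \<le> \<bar>2 * q\<^sup>2 - p\<^sup>2\<bar>" using twice_square_ne_square[of q p] q by linarith
    then have "1 \<le> real_of_int \<bar>2 * q\<^sup>2 - p\<^sup>2\<bar>" by linarith
    ultimately have "1 \<le> \<bar>real_of_int q * sqrt 2 - real_of_int p\<bar> * (4 * real_of_int q)" by linarith
    then show ?thesis using q by (simp add: powr_minus field_simps)
  qed
  moreover have "(0::real) < 1 / 4" by simp
  ultimately show ?thesis unfolding diophantine_real by blast
qed

section \<open>Counting coprime pairs\<close>

text \<open>Telescoping with \<open>1 / n - 1 / (n + 1)\<close>, starting from equality at
  \<open>n = 2\<close>. What matters is that the sum stays below 1.\<close>

lemma sum_inverse_squares_le: "2 \<le> n \<Longrightarrow> (\<Sum>d=2..n. 1 / (real d)\<^sup>2) \<le> 3 / 4 - 1 / real n"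
proof (induction n rule: nat_induct_at_least)
  case (Suc n)
  have "1 / (real (Suc n))\<^sup>2 \<le> 1 / real n - 1 / real (Suc n)"
  proof -
    have "1 / (real (Suc n))\<^sup>2 \<le> 1 / (real n * real (Suc n))"
      using Suc(1) by (intro divide_left_mono) (auto simp: power2_eq_square)
    also have "\<dots> = 1 / real n - 1 / real (Suc n)" using Suc(1) by (simp add: field_simps)
    finally show ?thesis .
  qed
  with Suc show ?case by simp
qed (simp add: power2_eq_square)

lemma card_multiples: "card {x\<in>{1..X}. d dvd x} = X div d" if "0 < d" for X d :: nat
proof -
  have "{x\<in>{1..X}. d dvd x} = (\<lambda>k. d * k) ` {1..X div d}"
    using that by (auto simp: less_eq_div_iff_mult_less_eq mult.commute elim!: dvdE)
  then show ?thesis using that by (simp add: card_image inj_on_def)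
qed

text \<open>A pair that is not coprime has a common divisor \<open>d \<ge> 2\<close>, shared by at
  most \<open>(X / d)^2\<close> pairs; summed over all \<open>d\<close>, prime or not, this removes
  at most three quarters of the square.\<close>

lemma card_coprime_pairs:
  "real X ^ 2 / 4 \<le> real (card {(a, b). a \<in> {1..X} \<and> b \<in> {1..X} \<and> coprime a b})" (is "_ \<le> real (card ?C)")
proof -
  let ?D = "\<lambda>d. {x\<in>{1..X}. d dvd x}"
  have "{1..X} \<times> {1..X} \<subseteq> ?C \<union> (\<Union>d\<in>{2..X}. ?D d \<times> ?D d)"
  proof clarsimp
    fix a b assume ab: "Suc 0 \<le> a" "a \<le> X" "Suc 0 \<le> b" "b \<le> X" and nd: "\<forall>x\<in>{2..X}. x dvd a \<longrightarrow> \<not> x dvd b"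
    have "gcd a b = 1"
    proof (rule ccontr)
      assume "gcd a b \<noteq> 1"
      moreover have "gcd a b \<noteq> 0" using ab by auto
      moreover have "gcd a b \<le> X" using ab gcd_le1_nat[of a b] by linarith
      ultimately have "2 \<le> gcd a b" "gcd a b \<le> X" by linarith+
      then have "gcd a b \<in> {2..X}" by simp
      then show False using nd by (meson gcd_dvd1 gcd_dvd2)
    qed
    then show "coprime a b" by (simp add: coprime_iff_gcd_eq_1)
  qed
  moreover have "finite ?C" by (rule finite_subset[of _ "{1..X} \<times> {1..X}"]) auto
  ultimately have "card ({1..X} \<times> {1..X}) \<le> card (?C \<union> (\<Union>d\<in>{2..X}. ?D d \<times> ?D d))"
    by (intro card_mono) auto
  then have "X * X \<le> card (?C \<union> (\<Union>d\<in>{2..X}. ?D d \<times> ?D d))" by (simp add: card_cartesian_product)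
  also have "\<dots> \<le> card ?C + card (\<Union>d\<in>{2..X}. ?D d \<times> ?D d)" by (rule card_Un_le)
  also have "card (\<Union>d\<in>{2..X}. ?D d \<times> ?D d) \<le> (\<Sum>d=2..X. card (?D d \<times> ?D d))" by (rule card_UN_le) simp
  also have "\<dots> = (\<Sum>d=2..X. (X div d)\<^sup>2)"
  proof (rule sum.cong)
    show "card (?D d \<times> ?D d) = (X div d)\<^sup>2" if "d \<in> {2..X}" for d
      using that unfolding card_cartesian_product power2_eq_square by (subst (1 2) card_multiples) auto
  qed simp
  finally have "real X ^ 2 \<le> real (card ?C) + (\<Sum>d=2..X. (real (X div d))\<^sup>2)"
    unfolding power2_eq_square by (simp flip: of_nat_mult of_nat_add of_nat_sum)
  also have "(\<Sum>d=2..X. (real (X div d))\<^sup>2) \<le> (\<Sum>d=2..X. real X ^ 2 * (1 / (real d)\<^sup>2))"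
  proof (rule sum_mono)
    fix d assume "d \<in> {2..X}"
    have "(real (X div d))\<^sup>2 \<le> (real X / real d)\<^sup>2"
      by (intro power_mono of_nat_div_le_of_nat) simp
    then show "(real (X div d))\<^sup>2 \<le> real X ^ 2 * (1 / (real d)\<^sup>2)" by (simp add: power_divide)
  qed
  also have "\<dots> = real X ^ 2 * (\<Sum>d=2..X. 1 / (real d)\<^sup>2)" by (simp add: sum_distrib_left)
  also have "(\<Sum>d=2..X. 1 / (real d)\<^sup>2) \<le> 3 / 4"
  proof (cases "2 \<le> X")
    case True
    then show ?thesis using sum_inverse_squares_le[OF True] by (smt (verit) divide_nonneg_nonneg of_nat_0_le_iff)
  qed simp
  finally show ?thesis by (simp add: mult_left_mono)
qed

text \<open>Bezout's identity gives a second row; subtracting a multiple of the first row brings its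
  first entry into \<open>[0, a)\<close>, and the determinant then confines the other entry to
  \<open>[0, b]\<close>.\<close>

lemma complete_to_SL2Z:
  fixes a b X :: nat
  assumes "coprime a b" "a \<in> {1..X}" "b \<in> {1..X}"
  obtains h :: "real^2^2" where "h \<in> SL2Z" "h$1$1 = real a" "h$1$2 = real b" "\<And>i j. 0 \<le> h$i$j \<and> h$i$j \<le> real X"
proof -
  obtain x y where xy: "x * int a + y * int b = 1"
    using bezout_int[of "int a" "int b"] assms(1) by (auto simp: coprime_iff_gcd_eq_1)
  define c where "c = (- y) mod int a"
  define d where "d = x - (- y) div int a * int b"
  have "- y = int a * ((- y) div int a) + c" unfolding c_def by simp
  then have d: "1 + c * int b = int a * d" unfolding d_def using xy by algebra
  have c: "0 \<le> c" "c < int a" using assms(2) by (auto simp: c_def)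
  have "1 + c * int b \<le> int a * int b"
  proof -
    have "c * int b \<le> (int a - 1) * int b" using c assms(3) by (intro mult_right_mono) auto
    then show ?thesis using assms(3) by (simp add: algebra_simps)
  qed
  then have "int a * d \<le> int a * int b" using d by simp
  then have d2: "d \<le> int b" using assms(2) by simp
  have "0 < int a * d" using d c by (metis add_pos_nonneg mult_nonneg_nonneg of_nat_0_le_iff zero_less_one)
  then have d1: "0 \<le> d" using assms(2) by (simp add: zero_less_mult_iff)
  define h where "h = (vector [vector [real a, real b], vector [real_of_int c, real_of_int d]] :: real^2^2)"
  have "det h = real_of_int (int a * d) - real_of_int (c * int b)" by (simp add: h_def det_2)
  also have "\<dots> = 1" unfolding d[symmetric] by simp
  finally have "h \<in> SL2Z" unfolding SL2Z_def by (auto simp: h_def forall_2)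
  moreover have "0 \<le> h$i$j \<and> h$i$j \<le> real X" for i j
  proof -
    have "real_of_int c \<le> real X" "real_of_int d \<le> real X" using c d2 assms by auto
    then have "\<forall>i j. 0 \<le> h$i$j \<and> h$i$j \<le> real X" using c d1 assms by (simp add: h_def forall_2)
    then show ?thesis by blast
  qed
  ultimately show ?thesis by (intro that[of h]) (auto simp: h_def)
qed

section \<open>Orbit points from powers of a hyperbolic matrix\<close>

lemma SL2Z_mult: "A \<in> SL2Z \<Longrightarrow> B \<in> SL2Z \<Longrightarrow> A ** B \<in> SL2Z"
  by (auto simp: SL2Z_def det_mul) (auto simp: matrix_matrix_mult_def intro!: Ints_sum Ints_mult)

text \<open>Eigenvectors of the matrix with rows (3, 2) and (4, 3), which lies in SL(2,Z), for the eigenvalue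
  \<open>3 + 2 * sqrt 2\<close> and its inverse.\<close>

definition eig :: "real^2" where "eig = vector [1, sqrt 2]"
definition eig' :: "real^2" where "eig' = vector [1, - sqrt 2]"

lemma eigenmatrix:
  "\<exists>M\<in>SL2Z. M *v eig = (1 / (3 + 2 * sqrt 2) ^ k) *\<^sub>R eig \<and> M *v eig' = (3 + 2 * sqrt 2) ^ k *\<^sub>R eig'"
proof (induction k)
  case 0
  have "mat 1 \<in> SL2Z" by (auto simp: SL2Z_def) (auto simp: mat_def)
  then show ?case by (intro bexI[of _ "mat 1"]) auto
next
  case (Suc k)
  define l where "l = 3 + 2 * sqrt 2"
  obtain M where M: "M \<in> SL2Z" "M *v eig = (1 / l ^ k) *\<^sub>R eig" "M *v eig' = l ^ k *\<^sub>R eig'"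
    using Suc unfolding l_def by blast
  \<comment> \<open>The inverse of the matrix with rows (3, 2) and (4, 3), so that
    \<open>eig\<close> is contracted and \<open>eig'\<close> expanded.\<close>
  define B where "B = (vector [vector [3, - 2], vector [- 4, 3]] :: real^2^2)"
  have B: "B \<in> SL2Z" by (auto simp: B_def SL2Z_def det_2 forall_2)
  have "l * (3 - 2 * sqrt 2) = 1" by (simp add: l_def algebra_simps)
  then have l: "1 / l = 3 - 2 * sqrt 2" by (metis divide_eq_eq mult.commute mult_zero_left zero_neq_one)
  have "B *v eig = (1 / l) *\<^sub>R eig" unfolding l
    by (simp add: vec_eq_iff forall_2 matrix_vector_mult_2 B_def eig_def algebra_simps)
  moreover have "B *v eig' = l *\<^sub>R eig'" unfolding l_def
    by (simp add: vec_eq_iff forall_2 matrix_vector_mult_2 B_def eig'_def algebra_simps)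
  ultimately have "(M ** B) *v eig = (1 / l ^ Suc k) *\<^sub>R eig" "(M ** B) *v eig' = l ^ Suc k *\<^sub>R eig'"
    using M by (simp_all add: matrix_vector_mul_assoc[symmetric] matrix_vector_mult_scaleR mult.commute)
  then show ?case using SL2Z_mult[OF M(1) B] unfolding l_def by blast
qed

lemma power_bracket:
  fixes l m :: real assumes "1 < l" "1 \<le> m" obtains k where "l ^ k \<le> m" "m < l ^ Suc k"
proof -
  obtain n where "m < l ^ n" using real_arch_pow[OF assms(1)] by blast
  then have least: "m < l ^ (LEAST n. m < l ^ n)" by (rule LeastI)
  then have "(LEAST n. m < l ^ n) \<noteq> 0" using assms by (metis not_less power_0)
  then obtain k where k: "(LEAST n. m < l ^ n) = Suc k" by (metis not0_implies_Suc)
  then have "\<not> m < l ^ k" using not_less_Least[of k "\<lambda>n. m < l ^ n"] by simp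
  then show ?thesis using that[of k] least k by simp
qed

text \<open>The outer radius 6 exceeds the eigenvalue \<open>3 + 2 * sqrt 2\<close>, so a vector of
  size at least 1 that is divided repeatedly by this eigenvalue cannot jump over the
  annulus.\<close>

definition eig_ball :: "(real^2^2 \<Rightarrow> real) \<Rightarrow> real \<Rightarrow> (real^2^2) set" where
  "eig_ball N T = {g\<in>SL2Z_ball N T. 1 \<le> maxnorm (g *v eig) \<and> maxnorm (g *v eig) \<le> 6}"

text \<open>A matrix \<open>h\<close> with nonnegative entries at most \<open>X\<close> is moved into the ball by a power of the
  eigenmatrix that shrinks \<open>h eig\<close> to bounded size: the product of the sizes of \<open>h eig\<close> and \<open>h eig'\<close>
  does not change and is at most of order \<open>X\<^sup>2\<close>. Only about \<open>ln X\<close> powers occur, so few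
  matrices collide.\<close>

lemma card_eig_ball_ge:
  assumes N: "matrix_norm N"
  obtains K where "0 < K"
    "\<And>X. 1 \<le> X \<Longrightarrow> real X ^ 2 / 4 / (ln (3 * real X) + 1) \<le> real (card (eig_ball N (K * real X ^ 2)))"
proof -
  obtain K where K: "0 < K" "\<And>A. N A \<le> K * norm A" using matrix_norm_le[OF N] by blast
  define l where "l = 3 + 2 * sqrt 2"
  have s2: "1 < sqrt 2" "sqrt 2 < 3 / 2" by (simp, rule real_less_lsqrt) (auto simp: power2_eq_square)
  have l: "exp 1 < l" "l < 6" using s2 exp_le unfolding l_def by linarith+
  then have l1: "1 < l" using s2 unfolding l_def by linarith
  obtain M where M: "\<And>k. M k \<in> SL2Z" "\<And>k. M k *v eig = (1 / l ^ k) *\<^sub>R eig" "\<And>k. M k *v eig' = l ^ k *\<^sub>R eig'"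
    using eigenmatrix unfolding l_def by metis
  have "real X ^ 2 / 4 / (ln (3 * real X) + 1) \<le> real (card (eig_ball N (32 * K * real X ^ 2)))" if X: "1 \<le> X" for X
  proof -
    define Q where "Q = {(a, b). a \<in> {1..X} \<and> b \<in> {1..X} \<and> coprime a b}"
    define L where "L = nat \<lfloor>ln (3 * real X)\<rfloor>"
    have X': "1 \<le> real X" using X by simp
    have "\<exists>h k. h \<in> SL2Z \<and> h$1$1 = real (fst p) \<and> h$1$2 = real (snd p) \<and> k \<in> {..L} \<and>
        h ** M k \<in> eig_ball N (32 * K * real X ^ 2)" if p: "p \<in> Q" for p
    proof -
      obtain a b where ab: "p = (a, b)" "a \<in> {1..X}" "b \<in> {1..X}" "coprime a b" using p by (auto simp: Q_def)
      obtain h :: "real^2^2" where h: "h \<in> SL2Z" "h$1$1 = real a" "h$1$2 = real b" "\<And>i j. 0 \<le> h$i$j \<and> h$i$j \<le> real X"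
        using complete_to_SL2Z[OF ab(4,2,3)] by metis
      define m where "m = maxnorm (h *v eig)"
      have comp: "0 \<le> h$i$j * sqrt 2" "h$i$j * sqrt 2 \<le> real X * (3 / 2)" for i j
        using h(4)[of i j] s2 mult_mono[of "h$i$j" "real X" "sqrt 2" "3 / 2"] by simp_all
      have "m \<le> 3 * real X"
        using h(4)[of 1 1] h(4)[of 2 1] comp[of 1 2] comp[of 2 2]
        by (auto simp: m_def maxnorm_le_iff matrix_vector_mult_2 eig_def)
      have "1 \<le> (h *v eig)$1" using h(2) comp[of 1 2] ab by (simp add: matrix_vector_mult_2 eig_def)
      then have "1 \<le> m" unfolding m_def using component_le_maxnorm(1)[of "h *v eig"] by linarith
      have m': "maxnorm (h *v eig') \<le> 3 * real X"
        using h(4)[of 1 1] h(4)[of 2 1] comp[of 1 2] comp[of 2 2]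
        by (auto simp: maxnorm_le_iff matrix_vector_mult_2 eig'_def)
      obtain k where k: "l ^ k \<le> m" "m < l ^ Suc k" using power_bracket[OF l1 \<open>1 \<le> m\<close>] .
      have lk: "0 < l ^ k" using l1 by simp
      have lk6: "l * l ^ k \<le> 6 * l ^ k" using lk l by (intro mult_right_mono) auto
      have "exp (real k) = exp 1 ^ k" by (simp flip: exp_of_nat_mult)
      also have "\<dots> \<le> l ^ k" using l by (intro power_mono) auto
      finally have "exp (real k) \<le> 3 * real X" using k \<open>m \<le> 3 * real X\<close> by linarith
      then have "real k \<le> ln (3 * real X)" using X' by (simp add: ln_ge_iff)
      then have kL: "k \<in> {..L}" unfolding L_def by (simp add: le_nat_floor)
      define g where "g = h ** M k"
      have gu: "g *v eig = (1 / l ^ k) *\<^sub>R (h *v eig)"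
        using M by (simp add: g_def matrix_vector_mul_assoc[symmetric] matrix_vector_mult_scaleR)
      have gu': "g *v eig' = l ^ k *\<^sub>R (h *v eig')"
        using M by (simp add: g_def matrix_vector_mul_assoc[symmetric] matrix_vector_mult_scaleR)
      have "maxnorm (g *v eig) = m / l ^ k" using lk by (simp add: gu maxnorm_scaleR m_def)
      then have g1: "1 \<le> maxnorm (g *v eig)" "maxnorm (g *v eig) \<le> 6"
        using k lk lk6 by (simp_all add: field_simps)
      have "maxnorm (g *v eig') \<le> (3 * real X) * (3 * real X)"
        unfolding gu' maxnorm_scaleR using k m' \<open>m \<le> 3 * real X\<close> lk by (intro mult_mono) auto
      then have g2: "maxnorm (g *v eig') \<le> 9 * real X ^ 2" by (simp add: power2_eq_square)
      have X2: "1 \<le> real X ^ 2" using X' by simp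
      \<comment> \<open>A row of \<open>g\<close> is recovered from half the sum and half the
        difference of its pairings with \<open>eig\<close> and \<open>eig'\<close>.\<close>
      have row: "\<bar>g$i$1\<bar> \<le> 8 * real X ^ 2 \<and> \<bar>g$i$2\<bar> \<le> 8 * real X ^ 2" for i
      proof -
        have "\<bar>(g *v eig)$i\<bar> \<le> 6" "\<bar>(g *v eig')$i\<bar> \<le> 9 * real X ^ 2"
          using g1(2) g2 exhaust_2[of i] component_le_maxnorm order_trans by metis+
        then have e: "\<bar>g$i$1 + g$i$2 * sqrt 2\<bar> \<le> 6" "\<bar>g$i$1 - g$i$2 * sqrt 2\<bar> \<le> 9 * real X ^ 2"
          by (simp_all add: matrix_vector_mult_def sum_2 eig_def eig'_def)
        then have "\<bar>g$i$2 * sqrt 2\<bar> \<le> 8 * real X ^ 2" using X2 by linarith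
        moreover have "\<bar>g$i$2\<bar> * 1 \<le> \<bar>g$i$2\<bar> * sqrt 2" using s2 by (intro mult_left_mono) auto
        ultimately show ?thesis using e X2 by (auto simp: abs_mult)
      qed
      have "norm g \<le> 4 * (8 * real X ^ 2)"
        by (rule norm_matrix_le) (metis row exhaust_2)
      then have "N g \<le> 32 * K * real X ^ 2"
        using order_trans[OF K(2)[of g] mult_left_mono[of "norm g" "4 * (8 * real X ^ 2)" K]] K(1) by simp
      then have "g \<in> eig_ball N (32 * K * real X ^ 2)"
        using g1 SL2Z_mult[OF h(1) M(1)] by (simp add: eig_ball_def SL2Z_ball_def g_def)
      then show ?thesis using h ab kL unfolding g_def by auto
    qed
    then obtain h k where hk: "\<And>p. p \<in> Q \<Longrightarrow> h p \<in> SL2Z \<and> h p$1$1 = real (fst p) \<and> h p$1$2 = real (snd p) \<and> k p \<in> {..L} \<and>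
        h p ** M (k p) \<in> eig_ball N (32 * K * real X ^ 2)"
      by metis
    \<comment> \<open>Recording the power \<open>k p\<close> restores injectivity: once it is fixed,
      the images of both eigenvectors give back the first row of \<open>h p\<close>, hence
      \<open>p\<close>.\<close>
    have "inj_on (\<lambda>p. (h p ** M (k p), k p)) Q"
    proof (rule inj_onI, clarsimp simp only: prod.inject)
      fix a b a' b'
      assume Q: "(a, b) \<in> Q" "(a', b') \<in> Q" and eq: "h (a, b) ** M (k (a', b')) = h (a', b') ** M (k (a', b'))" "k (a, b) = k (a', b')"
      have lk: "l ^ k (a', b') \<noteq> 0" using l1 by simp
      have *: "h (a, b) *v (M (k (a', b')) *v x) = h (a', b') *v (M (k (a', b')) *v x)" for x
        using eq(1) by (simp only: matrix_vector_mul_assoc)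
      have "h (a, b) *v eig = h (a', b') *v eig" "h (a, b) *v eig' = h (a', b') *v eig'"
        using *[of eig] *[of eig'] lk by (auto simp: M matrix_vector_mult_scaleR)
      then have "(h (a, b) *v eig)$1 = (h (a', b') *v eig)$1" "(h (a, b) *v eig')$1 = (h (a', b') *v eig')$1"
        by auto
      then have "real a + real b * sqrt 2 = real a' + real b' * sqrt 2" "real a - real b * sqrt 2 = real a' - real b' * sqrt 2"
        using hk[OF Q(1)] hk[OF Q(2)] by (simp_all add: matrix_vector_mult_2 eig_def eig'_def)
      then have "real a = real a'" "real b * sqrt 2 = real b' * sqrt 2" by linarith+
      then show "a = a' \<and> b = b'" by simp
    qed
    moreover have fin: "finite (eig_ball N (32 * K * real X ^ 2))"
      unfolding eig_ball_def using finite_SL2Z_ball[OF N] by simp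
    ultimately have "card Q \<le> card (eig_ball N (32 * K * real X ^ 2) \<times> {..L})"
      using hk by (intro card_inj_on_le) auto
    then have "real (card Q) \<le> real (card (eig_ball N (32 * K * real X ^ 2)) * (L + 1))"
      unfolding of_nat_le_iff card_cartesian_product by simp
    also have "\<dots> = real (card (eig_ball N (32 * K * real X ^ 2))) * (real L + 1)"
      by (simp add: algebra_simps)
    also have "real L \<le> ln (3 * real X)" unfolding L_def using X' by simp
    finally have "real X ^ 2 / 4 \<le> real (card (eig_ball N (32 * K * real X ^ 2))) * (ln (3 * real X) + 1)"
      using card_coprime_pairs[of X] unfolding Q_def by (simp add: mult_left_mono)
    moreover have "0 < ln (3 * real X) + 1" using X' by (intro add_nonneg_pos) auto
    ultimately show ?thesis by (subst pos_divide_le_eq)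
  qed
  moreover have "0 < 32 * K" using K by simp
  ultimately show ?thesis using that by blast
qed

text \<open>\<open>T / ln T\<close> eventually exceeds every \<open>C * T powr (1 - \<rho>)\<close>.
  The contradictions drawn from this ask only for some large \<open>T\<close>, so values
  \<open>T = K * X^2\<close> are enough.\<close>

lemma card_eig_ball_superpower:
  assumes N: "matrix_norm N" and \<rho>: "0 < \<rho>"
  obtains T where "T1 \<le> T" "C * T powr (1 - \<rho>) < real (card (eig_ball N T))"
proof -
  obtain K where K: "0 < K" "\<And>X. 1 \<le> X \<Longrightarrow> real X ^ 2 / 4 / (ln (3 * real X) + 1) \<le> real (card (eig_ball N (K * real X ^ 2)))"
    using card_eig_ball_ge[OF N] by metis
  have "\<forall>\<^sub>F X in sequentially. 1 \<le> X" by (rule eventually_ge_at_top)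
  moreover have "\<forall>\<^sub>F X in sequentially. T1 \<le> K * real X ^ 2" using K(1) by real_asymp
  moreover have "\<forall>\<^sub>F X in sequentially. C * (K * real X ^ 2) powr (1 - \<rho>) < real X ^ 2 / 4 / (ln (3 * real X) + 1)"
    using K(1) \<rho> by real_asymp
  ultimately have "\<forall>\<^sub>F X in sequentially. T1 \<le> K * real X ^ 2 \<and> C * (K * real X ^ 2) powr (1 - \<rho>) < real (card (eig_ball N (K * real X ^ 2)))"
    by eventually_elim (use K(2) in force)
  then show ?thesis using that unfolding eventually_sequentially by blast
qed

section \<open>Dirichlet approximation in orbits\<close>

text \<open>The multiple \<open>s * (a, c)\<close> of a primitive vector approximates
  \<open>v\<close> by Dirichlet's theorem for its slope. The column \<open>(b, d)\<close> completes
  \<open>(a, c)\<close> to determinant 1; reducing a Bezout coefficient modulo \<open>a\<close>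
  keeps it of the same size. A vertical \<open>v\<close> is a multiple of (0, 1) itself.\<close>

lemma target_approximation:
  fixes v :: "real^2"
  obtains C where "1 \<le> C"
    "\<And>X::nat. 1 \<le> X \<Longrightarrow> \<exists>(a::int) (b::int) (c::int) (d::int) s. b * c - a * d = 1 \<and>
       (\<forall>x\<in>{a, b, c, d}. \<bar>real_of_int x\<bar> \<le> C * real X) \<and> \<bar>s\<bar> \<le> C \<and>
       maxnorm (s *\<^sub>R vector [real_of_int a, real_of_int c] - v) \<le> C / real X"
proof (cases "v$1 = 0")
  case True
  show ?thesis
  proof (rule that[of "1 + \<bar>v$2\<bar>"])
    fix X :: nat assume "1 \<le> X"
    then have "1 * 1 \<le> (1 + \<bar>v$2\<bar>) * real X" by (intro mult_mono) auto
    moreover have "v$2 *\<^sub>R vector [0, 1] = v" using True by (simp add: vec_eq_iff forall_2)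
    ultimately show "\<exists>(a::int) (b::int) (c::int) (d::int) s. b * c - a * d = 1 \<and>
       (\<forall>x\<in>{a, b, c, d}. \<bar>real_of_int x\<bar> \<le> (1 + \<bar>v$2\<bar>) * real X) \<and> \<bar>s\<bar> \<le> 1 + \<bar>v$2\<bar> \<and>
       maxnorm (s *\<^sub>R vector [real_of_int a, real_of_int c] - v) \<le> (1 + \<bar>v$2\<bar>) / real X"
      by (intro exI[of _ 0] exI[of _ 1] exI[of _ "v$2"]) simp
  qed simp
next
  case False
  define \<sigma> where "\<sigma> = v$2 / v$1"
  define C where "C = \<bar>\<sigma>\<bar> + 2 + \<bar>v$1\<bar>"
  show ?thesis
  proof (rule that[of C])
    show "1 \<le> C" by (simp add: C_def)
    fix X :: nat assume X: "1 \<le> X"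
    obtain h k where hk: "coprime h k" "0 < k" "k \<le> int X" "\<bar>of_int k * \<sigma> - of_int h\<bar> < 1 / real X"
      using Dirichlet_approx_coprime[of X \<sigma>] X by auto
    have k: "1 \<le> real_of_int k" "real_of_int k \<le> real X" using hk by linarith+
    obtain x y where xy: "x * h + y * k = 1" using bezout_int[of h k] hk(1) by (auto simp: coprime_iff_gcd_eq_1)
    define b d where "b = x mod k" and "d = - y - x div k * h"
    have "x = k * (x div k) + b" unfolding b_def by simp
    then have det: "b * h - k * d = 1" unfolding d_def using xy by algebra
    have b: "0 \<le> b" "b < k" using hk by (auto simp: b_def)
    have "\<bar>real_of_int k * \<sigma>\<bar> \<le> real X * \<bar>\<sigma>\<bar>" using k by (auto simp: abs_mult intro!: mult_mono)
    moreover have "1 / real X \<le> 1" using X by simp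
    ultimately have h: "\<bar>real_of_int h\<bar> \<le> real X * \<bar>\<sigma>\<bar> + 1" using hk(4) by linarith
    have d: "\<bar>d\<bar> \<le> \<bar>h\<bar> + 1"
    proof -
      have "k * \<bar>d\<bar> = \<bar>b * h - 1\<bar>" using det hk(2) by (metis abs_mult abs_of_pos add_diff_cancel_left' add_diff_cancel_right' diff_add_cancel)
      also have "\<dots> \<le> b * \<bar>h\<bar> + 1" using b by (metis abs_mult abs_of_nonneg abs_one abs_triangle_ineq4)
      also have "\<dots> \<le> k * \<bar>h\<bar> + k * 1" using b hk by (intro add_mono mult_right_mono) auto
      also have "\<dots> = k * (\<bar>h\<bar> + 1)" by (simp add: algebra_simps)
      finally show ?thesis using hk(2) by simp
    qed
    have CX: "real X * \<bar>\<sigma>\<bar> + 2 * real X \<le> C * real X" by (simp add: C_def algebra_simps)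
    have "real X \<ge> 1" using X by simp
    then have "\<forall>z\<in>{k, b, h, d}. \<bar>real_of_int z\<bar> \<le> C * real X"
    proof -
      define Y where "Y = real X * \<bar>\<sigma>\<bar>"
      have Y: "0 \<le> Y" "Y + 2 * real X \<le> C * real X" using CX by (simp_all add: Y_def)
      have hY: "\<bar>real_of_int h\<bar> \<le> Y + 1" using h by (simp add: Y_def)
      have "\<bar>real_of_int d\<bar> \<le> \<bar>real_of_int h\<bar> + 1" using d by linarith
      then have "\<bar>real_of_int d\<bar> \<le> Y + 2" using hY by linarith
      then have "\<bar>real_of_int d\<bar> \<le> C * real X" using Y \<open>real X \<ge> 1\<close> by linarith
      moreover have "\<bar>real_of_int h\<bar> \<le> C * real X" using hY Y \<open>real X \<ge> 1\<close> by linarith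
      moreover have "\<bar>real_of_int k\<bar> \<le> C * real X" using k Y by linarith
      moreover have "\<bar>real_of_int b\<bar> \<le> C * real X" using b k Y by linarith
      ultimately show ?thesis by simp
    qed
    moreover have "\<bar>v$1 / k\<bar> \<le> C"
    proof -
      have "\<bar>v$1 / k\<bar> \<le> \<bar>v$1\<bar> / 1" unfolding abs_divide using k by (intro divide_left_mono) auto
      then show ?thesis by (simp add: C_def)
    qed
    moreover have "maxnorm ((v$1 / k) *\<^sub>R vector [real_of_int k, real_of_int h] - v) \<le> C / real X"
    proof -
      have "v$1 / k * h - v$2 = - (v$1 / k) * (of_int k * \<sigma> - of_int h)"
        using False k by (simp add: \<sigma>_def field_simps)
      then have "\<bar>v$1 / k * h - v$2\<bar> = \<bar>v$1\<bar> / k * \<bar>of_int k * \<sigma> - of_int h\<bar>"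
        using k by (simp add: abs_mult)
      also have "\<dots> \<le> \<bar>v$1\<bar> / 1 * (1 / real X)" using hk(4) k by (intro mult_mono divide_left_mono) auto
      also have "\<dots> \<le> C / real X" by (simp add: C_def divide_right_mono)
      finally show ?thesis using False k X \<open>1 \<le> C\<close> by (simp add: maxnorm_le_iff)
    qed
    ultimately show "\<exists>(a::int) (b::int) (c::int) (d::int) s. b * c - a * d = 1 \<and>
       (\<forall>x\<in>{a, b, c, d}. \<bar>real_of_int x\<bar> \<le> C * real X) \<and> \<bar>s\<bar> \<le> C \<and>
       maxnorm (s *\<^sub>R vector [real_of_int a, real_of_int c] - v) \<le> C / real X"
      using det by blast
  qed
qed

text \<open>Dirichlet's theorem with bound \<open>M\<close> gives
  \<open>e < \<bar>u$1\<bar> / M\<close>, hence \<open>M \<le> \<bar>u$1\<bar> / e\<close>: the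
  coefficients are controlled by the value \<open>e\<close> actually reached, however far it falls
  below \<open>\<eta>\<close>. Irrationality excludes \<open>e = 0\<close>, and a change of sign
  makes it positive.\<close>

lemma source_approximation:
  fixes u :: "real^2"
  assumes irr: "irrational_slope u"
  obtains C where "0 < C"
    "\<And>\<eta>. 0 < \<eta> \<Longrightarrow> \<exists>(m::int) (n::int) e. coprime m n \<and> e = real_of_int m * u$1 + real_of_int n * u$2 \<and> 0 < e \<and> e < \<eta> \<and>
        \<bar>real_of_int m\<bar> \<le> C / e \<and> \<bar>real_of_int n\<bar> \<le> C / e"
proof -
  have u1: "u$1 \<noteq> 0" and s: "u$2 / u$1 \<notin> \<rat>" using irr by (auto simp: irrational_slope_def)
  define s where "s = u$2 / u$1"
  define C where "C = (\<bar>s\<bar> + 1) * \<bar>u$1\<bar>"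
  have C: "0 < C" using u1 by (simp add: C_def add_nonneg_pos)
  show ?thesis
  proof (rule that[OF C])
    fix \<eta> :: real assume \<eta>: "0 < \<eta>"
    define M where "M = nat \<lceil>\<bar>u$1\<bar> / \<eta>\<rceil> + 1"
    have M: "\<bar>u$1\<bar> / \<eta> \<le> real M" "1 \<le> real M" unfolding M_def by (simp, linarith) simp
    obtain h k where hk: "coprime h k" "0 < k" "k \<le> int M" "\<bar>of_int k * s - of_int h\<bar> < 1 / real M"
      using Dirichlet_approx_coprime[of M s] M by auto
    define e where "e = \<bar>k * u$2 - h * u$1\<bar>"
    have e: "e = \<bar>u$1\<bar> * \<bar>of_int k * s - of_int h\<bar>"
      using u1 by (simp add: e_def s_def right_diff_distrib mult.commute flip: abs_mult)
    have "of_int k * s - of_int h \<noteq> 0"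
    proof
      assume "of_int k * s - of_int h = 0"
      then have "s = of_int h / of_int k" using hk(2) by (simp add: field_simps)
      then show False using s by (simp add: s_def)
    qed
    then have e0: "0 < e" using u1 by (simp add: e)
    have eM: "e < \<bar>u$1\<bar> * (1 / real M)" unfolding e using hk(4) u1 by (intro mult_strict_left_mono) auto
    also have "\<dots> \<le> \<eta>" using M \<eta> by (simp add: field_simps)
    finally have e\<eta>: "e < \<eta>" .
    have "real M \<le> \<bar>u$1\<bar> / e" using eM e0 M by (simp add: field_simps)
    then have "(\<bar>s\<bar> + 1) * real M \<le> (\<bar>s\<bar> + 1) * (\<bar>u$1\<bar> / e)" by (intro mult_left_mono) auto
    then have Me: "\<bar>s\<bar> * real M + real M \<le> C / e" by (simp add: C_def algebra_simps)
    have k: "0 < real_of_int k" "real_of_int k \<le> real M" using hk by linarith+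
    have "\<bar>real_of_int k * s\<bar> \<le> \<bar>s\<bar> * real M" using k by (auto simp: abs_mult mult.commute intro!: mult_mono)
    moreover have "1 / real M \<le> 1" using M by simp
    ultimately have "\<bar>real_of_int h\<bar> \<le> \<bar>s\<bar> * real M + real M" using hk(4) M by linarith
    with Me have hC: "\<bar>real_of_int h\<bar> \<le> C / e" by linarith
    have "0 \<le> \<bar>s\<bar> * real M" by simp
    then have kC: "\<bar>real_of_int k\<bar> \<le> C / e" using k Me by linarith
    show "\<exists>(m::int) (n::int) e. coprime m n \<and> e = real_of_int m * u$1 + real_of_int n * u$2 \<and> 0 < e \<and> e < \<eta> \<and>
        \<bar>real_of_int m\<bar> \<le> C / e \<and> \<bar>real_of_int n\<bar> \<le> C / e"
    proof (cases "0 \<le> k * u$2 - h * u$1")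
      case True
      then show ?thesis using e0 e\<eta> hC kC hk(1)
        by (intro exI[of _ "- h"] exI[of _ k] exI[of _ e]) (auto simp: e_def)
    next
      case False
      then show ?thesis using e0 e\<eta> hC kC hk(1)
        by (intro exI[of _ h] exI[of _ "- k"] exI[of _ e]) (auto simp: e_def)
    qed
  qed
qed

text \<open>The right factor of \<open>g t\<close> sends \<open>u\<close> to \<open>(e, e')\<close>;
  adding \<open>t\<close> times its first row to the second moves \<open>e'\<close> in steps of
  \<open>e\<close> to within \<open>2 * e\<close> of \<open>s\<close>. The left factor sends this to
  \<open>e * (b, d) + e' * (a, c)\<close>, close to \<open>s * (a, c)\<close> and so to
  \<open>v\<close>. The entries are at most of order \<open>q powr (-4)\<close> on the right and
  \<open>q powr (-1)\<close> on the left, whence the fifth power.\<close>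

lemma SL2Z_approximation:
  fixes u v :: "real^2"
  assumes irr: "irrational_slope u"
  obtains K where "0 < K"
    "\<And>\<eta>. 0 < \<eta> \<Longrightarrow> \<exists>q. 0 < q \<and> q < \<eta> \<and> (\<exists>g\<in>SL2Z. g *v u \<noteq> v \<and> maxnorm (g *v u - v) \<le> K * q \<and> norm g \<le> K / q ^ 5)"
proof -
  obtain C1 where C1: "1 \<le> C1"
    "\<And>X::nat. 1 \<le> X \<Longrightarrow> \<exists>(a::int) (b::int) (c::int) (d::int) s. b * c - a * d = 1 \<and>
       (\<forall>x\<in>{a, b, c, d}. \<bar>real_of_int x\<bar> \<le> C1 * real X) \<and> \<bar>s\<bar> \<le> C1 \<and>
       maxnorm (s *\<^sub>R vector [real_of_int a, real_of_int c] - v) \<le> C1 / real X"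
    using target_approximation[of v] by metis
  obtain C2 where C2: "0 < C2"
    "\<And>\<eta>. 0 < \<eta> \<Longrightarrow> \<exists>(m::int) (n::int) e. coprime m n \<and> e = real_of_int m * u$1 + real_of_int n * u$2 \<and> 0 < e \<and> e < \<eta> \<and>
        \<bar>real_of_int m\<bar> \<le> C2 / e \<and> \<bar>real_of_int n\<bar> \<le> C2 / e"
    using source_approximation[OF irr] by metis
  define C3 where "C3 = maxnorm u + C2 * (C1 + 2)"
  have C3: "C2 \<le> C3" "0 < C3"
  proof -
    have "C2 * 1 \<le> C2 * (C1 + 2)" using C1(1) C2(1) by (intro mult_left_mono) auto
    then show "C2 \<le> C3" "0 < C3" using C2(1) maxnorm_nonneg[of u] unfolding C3_def by linarith+
  qed
  \<comment> \<open>7 = 2 + 4 + 1 collects the three parts of the distance; 16 is 4 for passing from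
    entries to the norm times 4 for an entry of the product.\<close>
  define K where "K = max (7 * C1) (16 * C1 * C3)"
  have "0 < K" using C1 by (simp add: K_def less_max_iff_disj)
  then show ?thesis
  proof (rule that)
    fix \<eta> :: real assume \<eta>: "0 < \<eta>"
    define \<eta>' where "\<eta>' = min 1 (\<eta>\<^sup>2)"
    obtain m n :: int and e where mn: "coprime m n" "e = real_of_int m * u$1 + real_of_int n * u$2" "0 < e" "e < \<eta>'"
      "\<bar>real_of_int m\<bar> \<le> C2 / e" "\<bar>real_of_int n\<bar> \<le> C2 / e"
      using C2(2)[of \<eta>'] \<eta> by (auto simp: \<eta>'_def)
    \<comment> \<open>With \<open>X\<close> about \<open>1 / q\<close> the two sources of error,
      \<open>e * X\<close> and \<open>1 / X\<close>, balance.\<close>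
    define q where "q = sqrt e"
    have q2: "e = q\<^sup>2" and q0: "0 < q" using mn(3) by (auto simp: q_def)
    have "e < \<eta>\<^sup>2" "e < 1" using mn(4) by (simp_all add: \<eta>'_def)
    then have "sqrt e < sqrt (\<eta>\<^sup>2)" "sqrt e < sqrt 1" by (simp_all only: real_sqrt_less_iff)
    then have q1: "q < 1" and q\<eta>: "q < \<eta>" using \<eta> by (simp_all add: q_def)
    define X where "X = nat \<lceil>1 / q\<rceil>"
    have iq: "1 \<le> 1 / q" using q0 q1 by simp
    then have X: "1 / q \<le> real X" "real X \<le> 2 / q" unfolding X_def by linarith (use iq in linarith)
    then have "1 \<le> X" using iq by linarith
    obtain a b c d :: int and s where abcd: "b * c - a * d = 1"
       "\<And>x. x \<in> {a, b, c, d} \<Longrightarrow> \<bar>real_of_int x\<bar> \<le> C1 * real X" "\<bar>s\<bar> \<le> C1"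
       "maxnorm (s *\<^sub>R vector [real_of_int a, real_of_int c] - v) \<le> C1 / real X"
      using C1(2)[OF \<open>1 \<le> X\<close>] by blast
    have ent: "\<bar>real_of_int x\<bar> \<le> 2 * C1 / q" if "x \<in> {a, b, c, d}" for x
      using abcd(2)[OF that] mult_left_mono[OF X(2), of C1] C1(1) by (simp add: mult.commute)
    have "C1 / real X \<le> C1 / (1 / q)" 
      using X(1) q0 C1(1) \<open>1 \<le> X\<close> by (intro divide_left_mono mult_pos_pos) auto
    then have sv: "maxnorm (s *\<^sub>R vector [real_of_int a, real_of_int c] - v) \<le> C1 * q" using abcd(4) by simp
    obtain x y where xy: "x * m + y * n = 1" using bezout_int[of m n] mn(1) by (auto simp: coprime_iff_gcd_eq_1)
    define e0 where "e0 = real_of_int x * u$2 - real_of_int y * u$1"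
    define l0 where "l0 = \<lceil>(s - e0) / e\<rceil>"
    define g where "g t = (vector [vector [real_of_int b, real_of_int a], vector [real_of_int d, real_of_int c]] :: real^2^2)
       ** (vector [vector [real_of_int m, real_of_int n], vector [real_of_int (t * m - y), real_of_int (t * n + x)]] :: real^2^2)" for t :: int
    have gu: "g t *v u = e *\<^sub>R vector [real_of_int b, real_of_int d] + (e0 + real_of_int t * e) *\<^sub>R vector [real_of_int a, real_of_int c]" for t :: int
      unfolding g_def
      by (simp add: matrix_vector_mul_assoc[symmetric] vec_eq_iff forall_2 matrix_vector_mult_2 mn(2) e0_def algebra_simps)
    \<comment> \<open>Two consecutive values of \<open>t\<close> give different images of
      \<open>u\<close>, so at least one of them misses \<open>v\<close>. Distances that are small
      but not 0 are what later yields infinitely many matrices.\<close>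
    have "g (l0 + 1) *v u - g l0 *v u = e *\<^sub>R vector [real_of_int a, real_of_int c]"
      unfolding gu by (simp add: algebra_simps)
    moreover have "(vector [real_of_int a, real_of_int c] :: real^2) \<noteq> 0"
      using abcd(1) by (auto simp: vec_eq_iff forall_2)
    ultimately have "g (l0 + 1) *v u \<noteq> g l0 *v u" using mn(3) by (metis eq_iff_diff_eq_0 less_irrefl scaleR_eq_0_iff)
    then obtain t where t: "t = l0 \<or> t = l0 + 1" "g t *v u \<noteq> v" by metis
    define e' where "e' = e0 + real_of_int t * e"
    have "(s - e0) / e \<le> real_of_int l0" "real_of_int l0 < (s - e0) / e + 1" unfolding l0_def by linarith+
    then have "(s - e0) / e \<le> real_of_int t" "real_of_int t \<le> (s - e0) / e + 2" using t(1) by auto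
    then have "(s - e0) / e * e \<le> real_of_int t * e" "real_of_int t * e \<le> ((s - e0) / e + 2) * e" 
      using mn(3) by (simp_all only: mult_right_mono less_imp_le)
    then have e's: "0 \<le> e' - s" "e' - s \<le> 2 * e" using mn(3) by (auto simp: e'_def distrib_right)
    have "maxnorm (g t *v u - v) \<le> K * q"
    proof -
      have "g t *v u - v = e *\<^sub>R vector [real_of_int b, real_of_int d] + ((e' - s) *\<^sub>R vector [real_of_int a, real_of_int c]
          + (s *\<^sub>R vector [real_of_int a, real_of_int c] - v))"
        unfolding gu e'_def[symmetric] by (simp add: algebra_simps)
      also have "maxnorm \<dots> \<le> e * maxnorm (vector [real_of_int b, real_of_int d]) + ((e' - s) * maxnorm (vector [real_of_int a, real_of_int c])
          + C1 * q)"
        using e's mn(3) sv by (intro order_trans[OF maxnorm_triangle] add_mono) (auto simp: maxnorm_scaleR)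
      also have "\<dots> \<le> e * (2 * C1 / q) + (2 * e * (2 * C1 / q) + C1 * q)"
        using e's mn(3) ent C1(1) q0 by (intro add_mono mult_mono) (auto simp: maxnorm_le_iff)
      also have "\<dots> = 7 * C1 * q" using q0 by (simp add: q2 power2_eq_square)
      also have "\<dots> \<le> K * q" using q0 by (simp add: K_def)
      finally show ?thesis .
    qed
    moreover have "norm (g t) \<le> K / q ^ 5"
    proof -
      define m' n' where "m' = t * m - y" and "n' = t * n + x"
      have e1: "e \<le> 1" using mn(4) by (simp add: \<eta>'_def)
      have ce: "C2 / e \<le> C3 / e\<^sup>2"
        using C3 mn(3) e1 C2(1) by (intro frac_le) (auto simp: power2_eq_square mult_le_cancel_left1)
      have det: "real_of_int m * real_of_int n' - real_of_int n * real_of_int m' = 1"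
        using xy unfolding m'_def n'_def by (simp add: algebra_simps flip: of_int_mult of_int_add)
      have e': "e' = real_of_int m' * u$1 + real_of_int n' * u$2" by (simp add: e'_def e0_def m'_def n'_def mn(2) algebra_simps)
      have "\<bar>e'\<bar> \<le> C1 + 2" using e's abcd(3) e1 by linarith
      have row: "\<bar>w\<bar> \<le> C3 / e\<^sup>2" if "e * w = z + r * e'" "\<bar>z\<bar> \<le> maxnorm u" "\<bar>r\<bar> \<le> C2 / e" for w z r :: real
      proof -
        have "\<bar>r * e'\<bar> \<le> C2 / e * (C1 + 2)"
          unfolding abs_mult using that(3) \<open>\<bar>e'\<bar> \<le> C1 + 2\<close> mn(3) C2(1) by (intro mult_mono) auto
        moreover have "e * \<bar>w\<bar> = \<bar>z + r * e'\<bar>" using that(1) mn(3) by (metis abs_mult abs_of_pos)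
        ultimately have "e * \<bar>w\<bar> \<le> maxnorm u + C2 / e * (C1 + 2)" using that(2) by linarith
        also have "\<dots> \<le> maxnorm u / e + C2 / e * (C1 + 2)"
          using mn(3) e1 mult_left_mono[of e 1 "maxnorm u"] by (simp add: field_simps)
        also have "\<dots> = C3 / e" by (simp add: C3_def add_divide_distrib)
        finally show ?thesis using mn(3) by (simp add: field_simps power2_eq_square)
      qed
      \<comment> \<open>Cramer's rule for the unimodular matrix with rows \<open>(m, n)\<close> and
        \<open>(m', n')\<close> applied to \<open>u\<close>; dividing by \<open>e\<close> costs one
        more factor \<open>1 / e\<close> than in the first row.\<close>
      have "e * real_of_int n' = u$1 + real_of_int n * e'" "e * real_of_int m' = - u$2 + real_of_int m * e'"
        using det unfolding e' mn(2) by algebra+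
      then have "\<bar>real_of_int m'\<bar> \<le> C3 / e\<^sup>2" "\<bar>real_of_int n'\<bar> \<le> C3 / e\<^sup>2"
        using row mn(5,6) component_le_maxnorm[of u] by (metis abs_minus_cancel)+
      moreover have "\<bar>real_of_int m\<bar> \<le> C3 / e\<^sup>2" "\<bar>real_of_int n\<bar> \<le> C3 / e\<^sup>2" using mn(5,6) ce by linarith+
      ultimately have M: "\<bar>real_of_int z\<bar> \<le> C3 / e\<^sup>2" if "z \<in> {m, n, m', n'}" for z using that by auto
      have prod: "\<bar>real_of_int p * real_of_int r + real_of_int p' * real_of_int r'\<bar> \<le> 4 * C1 * C3 / q ^ 5"
        if "p \<in> {a, b, c, d}" "p' \<in> {a, b, c, d}" "r \<in> {m, n, m', n'}" "r' \<in> {m, n, m', n'}" for p p' r r'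
      proof -
        have "\<bar>real_of_int p * real_of_int r + real_of_int p' * real_of_int r'\<bar>
          \<le> \<bar>real_of_int p\<bar> * \<bar>real_of_int r\<bar> + \<bar>real_of_int p'\<bar> * \<bar>real_of_int r'\<bar>"
          unfolding abs_mult[symmetric] by (rule abs_triangle_ineq)
        also have "\<dots> \<le> 2 * C1 / q * (C3 / e\<^sup>2) + 2 * C1 / q * (C3 / e\<^sup>2)"
          using q0 C1(1) by (intro add_mono mult_mono ent M that) auto
        also have "\<dots> = 4 * C1 * C3 / q ^ 5" by (simp add: q2 eval_nat_numeral)
        finally show ?thesis .
      qed
      have "\<forall>i j. \<bar>g t$i$j\<bar> \<le> 4 * C1 * C3 / q ^ 5"
        unfolding g_def m'_def[symmetric] n'_def[symmetric] forall_2
        by (simp add: matrix_matrix_mult_def sum_2 prod del: of_int_mult of_int_add)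
      then have "norm (g t) \<le> 4 * (4 * C1 * C3 / q ^ 5)" by (intro norm_matrix_le) blast
      also have "\<dots> \<le> K / q ^ 5" using q0 by (simp add: K_def divide_right_mono)
      finally show ?thesis .
    qed
    moreover have "g t \<in> SL2Z"
    proof -
      have "m * (t * n + x) - n * (t * m - y) = 1" using xy by (simp add: algebra_simps)
      then have "real_of_int (m * (t * n + x) - n * (t * m - y)) = 1" "real_of_int (b * c - a * d) = 1"
        using abcd(1) by simp_all
      then have "real_of_int (b * c - a * d) * real_of_int (m * (t * n + x) - n * (t * m - y)) = 1" by simp
      moreover have "det (g t) = real_of_int (b * c - a * d) * real_of_int (m * (t * n + x) - n * (t * m - y))"
        unfolding g_def det_mul by (simp add: det_2)
      ultimately have "det (g t) = 1" by simp
      moreover have "g t$i$j \<in> \<int>" for i j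
      proof -
        have "\<forall>i j. g t$i$j \<in> \<int>" unfolding g_def forall_2 by (simp add: matrix_matrix_mult_def sum_2)
        then show ?thesis by blast
      qed
      ultimately show ?thesis by (simp add: SL2Z_def)
    qed
    ultimately show "\<exists>q. 0 < q \<and> q < \<eta> \<and> (\<exists>g\<in>SL2Z. g *v u \<noteq> v \<and> maxnorm (g *v u - v) \<le> K * q \<and> norm g \<le> K / q ^ 5)"
      using q0 q\<eta> t(2) by blast
  qed
qed

text \<open>Among finitely many solutions, those with \<open>g *v u \<noteq> v\<close> would keep a
  positive distance from \<open>v\<close>, but \<open>SL2Z_approximation\<close> produces a closer
  one.\<close>

lemma infinitely_many_approximations:
  assumes N: "matrix_norm N" and irr: "irrational_slope u" and \<tau>: "0 \<le> \<tau>" "5 * \<tau> \<le> 1"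
  shows "\<exists>C>0. infinite {g \<in> SL2Z. maxnorm (g *v u - v) < C * N g powr (- \<tau>)}"
proof -
  obtain K where K: "0 < K"
    "\<And>\<eta>. 0 < \<eta> \<Longrightarrow> \<exists>q. 0 < q \<and> q < \<eta> \<and> (\<exists>g\<in>SL2Z. g *v u \<noteq> v \<and> maxnorm (g *v u - v) \<le> K * q \<and> norm g \<le> K / q ^ 5)"
    using SL2Z_approximation[OF irr, of v] by metis
  obtain L where L: "0 < L" "\<And>A. N A \<le> L * norm A" using matrix_norm_le[OF N] by blast
  define C where "C = 2 * K * (L * K) powr \<tau>"
  have C: "0 < C" using K(1) L(1) by (simp add: C_def)
  define S where "S = {g \<in> SL2Z. maxnorm (g *v u - v) < C * N g powr (- \<tau>)}"
  have "infinite S"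
  proof
    assume fin: "finite S"
    \<comment> \<open>The inserted 1 keeps the minimum defined when no solution misses
      \<open>v\<close>.\<close>
    define \<mu> where "\<mu> = Min (insert 1 ((\<lambda>g. maxnorm (g *v u - v)) ` {g\<in>S. g *v u \<noteq> v}))"
    have "0 < \<mu>" using fin unfolding \<mu>_def by (subst Min_gr_iff) (auto simp: maxnorm_pos_iff)
    then have "0 < min 1 (\<mu> / K)" using K(1) by simp
    then obtain q g where q: "0 < q" "q < min 1 (\<mu> / K)" and g: "g \<in> SL2Z" "g *v u \<noteq> v"
      "maxnorm (g *v u - v) \<le> K * q" "norm g \<le> K / q ^ 5"
      using K(2) by blast
    have "g \<noteq> 0" using g(1) by (auto simp: SL2Z_def det_2)
    then have Ng: "0 < N g" using N unfolding matrix_norm_def by (metis order_less_le)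
    have "N g \<le> L * (K / q ^ 5)" using L g(4) by (meson less_imp_le mult_left_mono order_trans)
    then have "(L * K / q ^ 5) powr (- \<tau>) \<le> N g powr (- \<tau>)" using Ng \<tau> by (intro powr_mono2') auto
    moreover have "(L * K / q ^ 5) powr (- \<tau>) = (L * K) powr (- \<tau>) * q powr (5 * \<tau>)"

    proof -
      have "(q ^ 5) powr (- \<tau>) = q powr (- (5 * \<tau>))"
        using q powr_realpow[of q 5] powr_powr[of q 5 "- \<tau>"] by simp
      then show ?thesis unfolding powr_divide by (simp add: powr_minus divide_inverse)
    qed
    \<comment> \<open>The condition \<open>5 * \<tau> \<le> 1\<close> says that distance
      \<open>q\<close> at size \<open>q powr (-5)\<close> is good enough for the exponent
      \<open>\<tau>\<close>; \<open>q < 1\<close> reverses the order of exponents.\<close>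
    moreover have "q powr 1 \<le> q powr (5 * \<tau>)" using q \<tau> by (intro powr_mono') auto
    then have "(L * K) powr (- \<tau>) * q \<le> (L * K) powr (- \<tau>) * q powr (5 * \<tau>)" using q by (intro mult_left_mono) auto
    ultimately have "(L * K) powr (- \<tau>) * q \<le> N g powr (- \<tau>)" by linarith
    then have "C * ((L * K) powr (- \<tau>) * q) \<le> C * N g powr (- \<tau>)" using C by simp
    moreover have "C * ((L * K) powr (- \<tau>) * q) = 2 * K * q"
      using L(1) K(1) by (simp add: C_def powr_minus field_simps)
    moreover have "0 < K * q" using K(1) q by simp
    ultimately have "maxnorm (g *v u - v) < C * N g powr (- \<tau>)" using g(3) by linarith
    then have "g \<in> S" using g(1) by (simp add: S_def)
    then have "\<mu> \<le> maxnorm (g *v u - v)" using g(2) fin unfolding \<mu>_def by (intro Min_le) auto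
    moreover have "K * q < \<mu>" using q K(1) by (simp add: field_simps)
    ultimately show False using g(3) by linarith
  qed
  then show ?thesis using C unfolding S_def by blast
qed

section \<open>Constraints on the exponent\<close>

lemma eig_slope: "eig$1 \<noteq> 0" "diophantine (ereal 2) (eig$2 / eig$1)"
  using diophantine_sqrt_2 by (simp_all add: eig_def)

text \<open>Every \<open>g\<close> in \<open>eig_ball\<close> has a tent centred at its own image,
  so the orbit sum is at least \<open>\<epsilon>\<close> per element, while the integral is at most
  proportional to the number of tents. The slope has exponent 2, so the error is of order
  \<open>1 + T powr (1 - \<delta>)\<close>. Of the integral only its bounds are passed on.\<close>

lemma eig_ball_discrepancy:
  assumes N: "matrix_norm N" and equi: "equidistribution_exponent N \<delta>"
  obtains C T0 where "0 < C" "1 \<le> T0"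
    "\<And>T \<epsilon>. T0 \<le> T \<Longrightarrow> eig_ball N T \<noteq> {} \<Longrightarrow> 0 < \<epsilon> \<Longrightarrow> \<epsilon> \<le> 1 / 2 \<Longrightarrow>
       \<exists>I. 0 \<le> I \<and> I \<le> C * real (card (eig_ball N T)) * \<epsilon>^3 \<and>
         real (card (eig_ball N T)) * \<epsilon> \<le> 2 * T / covolume * I + C * (1 + T powr (1 - \<delta>))"
proof -
  have e0: "eig \<noteq> 0" using eig_slope(1) by auto
  obtain C T0 where C: "0 < C" "1 \<le> T0" "\<And>P \<epsilon> T. bump_function P \<epsilon> 1 6 \<Longrightarrow> T0 \<le> T \<Longrightarrow>
       \<bar>orbit_sum N (bump P \<epsilon>) eig T
         - 2 * T / covolume * (LINT v:punctured_plane|lborel. bump P \<epsilon> v / star N v eig)\<bar>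
       \<le> C * (1 + T powr (1 - 2 * \<delta> / 2))"
    using bump_discrepancy[OF equi eig_slope, of 1 6] by auto
  obtain l L where l: "0 < l" "\<And>v. l * maxnorm v \<le> star N v eig" and L: "0 < L" "\<And>v. star N v eig \<le> L * maxnorm v"
    using star_bounds[OF N e0] by metis
  define C' where "C' = max C (8 / l)"
  show ?thesis
  proof (rule that)
    show "0 < C'" "1 \<le> T0" using C by (simp_all add: C'_def)
    fix T \<epsilon> :: real assume T: "T0 \<le> T" and ne: "eig_ball N T \<noteq> {}" and \<epsilon>: "0 < \<epsilon>" "\<epsilon> \<le> 1 / 2"
    define P where "P = (\<lambda>g. g *v eig) ` eig_ball N T"
    have finE: "finite (eig_ball N T)" using finite_SL2Z_ball[OF N] by (simp add: eig_ball_def)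
    interpret bump_function P \<epsilon> 1 6
      using finE ne \<epsilon> by unfold_locales (auto simp: P_def eig_ball_def)
    define I where "I = (LINT v:punctured_plane|lborel. f v / star N v eig)"
    have cardP: "card P \<le> card (eig_ball N T)" unfolding P_def using finE by (rule card_image_le)
    have I1: "I \<le> 8 / (l * 1) * real (card P) * \<epsilon>^3" "\<epsilon>^3 / (4 * L * 6) \<le> I"
      unfolding I_def by (rule integral_bounds[OF N e0 l L])+
    have "8 / (l * 1) * real (card P) * \<epsilon>^3 \<le> C' * real (card (eig_ball N T)) * \<epsilon>^3"
      
      using cardP l(1) C(1) \<epsilon> by (intro mult_mono mult_nonneg_nonneg) (auto simp: C'_def le_max_iff_disj)
    then have I2: "I \<le> C' * real (card (eig_ball N T)) * \<epsilon>^3" using I1 by linarith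
    have "0 \<le> \<epsilon>^3 / (4 * L * 6)" using \<epsilon> L(1) by simp
    then have I0: "0 \<le> I" using I1 by linarith
    have "real (card (eig_ball N T)) * \<epsilon> = (\<Sum>g\<in>eig_ball N T. \<epsilon>)" by simp
    also have "\<dots> \<le> (\<Sum>g\<in>eig_ball N T. f (g *v eig))"
      by (intro sum_mono at_center) (simp add: P_def)
    also have "\<dots> \<le> orbit_sum N f eig T"
      unfolding orbit_sum_def by (intro sum_mono2 finite_SL2Z_ball[OF N]) (auto simp: eig_ball_def nonneg)
    also have "\<dots> \<le> 2 * T / covolume * I + C * (1 + T powr (1 - \<delta>))"
      using C(3)[OF bump_function_axioms T] unfolding I_def by (simp add: abs_le_iff)
    also have "\<dots> \<le> 2 * T / covolume * I + C' * (1 + T powr (1 - \<delta>))"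
      by (intro add_left_mono mult_right_mono) (auto simp: C'_def add_nonneg_nonneg)
    finally show "\<exists>I. 0 \<le> I \<and> I \<le> C' * real (card (eig_ball N T)) * \<epsilon>^3 \<and>
         real (card (eig_ball N T)) * \<epsilon> \<le> 2 * T / covolume * I + C' * (1 + T powr (1 - \<delta>))"
      using I0 I2 by blast
  qed
qed

text \<open>Division by 0 gives 0, so a \<open>covolume\<close> that is not positive would remove
  the main term or make it nonpositive. With tents of fixed width 1/2 the estimate would then allow
  only \<open>T powr (1 - \<rho>)\<close> orbit points up to a constant, against the count.\<close>

lemma covolume_pos:
  assumes N: "matrix_norm N" and equi: "equidistribution_exponent N \<delta>"
  shows "0 < covolume"
proof (rule ccontr)
  assume cov: "\<not> 0 < covolume"
  obtain C T0 where C: "0 < C" "1 \<le> T0"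
    "\<And>T \<epsilon>. T0 \<le> T \<Longrightarrow> eig_ball N T \<noteq> {} \<Longrightarrow> 0 < \<epsilon> \<Longrightarrow> \<epsilon> \<le> 1 / 2 \<Longrightarrow>
       \<exists>I. 0 \<le> I \<and> I \<le> C * real (card (eig_ball N T)) * \<epsilon>^3 \<and>
         real (card (eig_ball N T)) * \<epsilon> \<le> 2 * T / covolume * I + C * (1 + T powr (1 - \<delta>))"
    using eig_ball_discrepancy[OF N equi] by metis
  have d: "0 < \<delta>" using equi by (simp add: equidistribution_exponent_def)
  \<comment> \<open>The cap at 1 lets \<open>T powr (1 - \<rho>)\<close> dominate the constant term
    of the error as well.\<close>
  define \<rho> where "\<rho> = min 1 \<delta>"
  have \<rho>: "0 < \<rho>" "\<rho> \<le> 1" "\<rho> \<le> \<delta>" using d by (auto simp: \<rho>_def)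
  obtain T where T: "T0 \<le> T" "4 * C * T powr (1 - \<rho>) < real (card (eig_ball N T))"
    using card_eig_ball_superpower[OF N \<rho>(1)] by metis
  have T1: "1 \<le> T" using C(2) T(1) by linarith
  have "0 \<le> 4 * C * T powr (1 - \<rho>)" using C(1) by simp
  then have ne: "eig_ball N T \<noteq> {}" using T(2) by auto
  obtain I where I: "0 \<le> I" "real (card (eig_ball N T)) * (1 / 2) \<le> 2 * T / covolume * I + C * (1 + T powr (1 - \<delta>))"
    using C(3)[OF T(1) ne, of "1 / 2"] by auto
  have "2 * T / covolume * I \<le> 0"
    using cov I(1) T1 by (intro mult_nonpos_nonneg divide_nonneg_nonpos) auto
  moreover have "1 + T powr (1 - \<delta>) \<le> T powr (1 - \<rho>) + T powr (1 - \<rho>)"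
    using T1 \<rho> by (intro add_mono powr_mono ge_one_powr_ge_zero) auto
  then have "C * (1 + T powr (1 - \<delta>)) \<le> C * (T powr (1 - \<rho>) + T powr (1 - \<rho>))"
    using C(1) by (intro mult_left_mono) auto
  ultimately have "real (card (eig_ball N T)) * (1 / 2) \<le> C * (T powr (1 - \<rho>) + T powr (1 - \<rho>))"
    using I(2) by linarith
  then show False using T(2) by (simp add: algebra_simps)
qed

text \<open>The bumps are centred at the orbit points themselves. At width of order \<open>1 / sqrt T\<close> the orbit sum
  is then at least twice its main term, and the excess, of order almost \<open>sqrt T\<close>, contradicts an error
  \<open>T powr (1 - \<delta>)\<close> with \<open>\<delta> > 1 / 2\<close>.\<close>

lemma exponent_le_half:
  assumes N: "matrix_norm N" and equi: "equidistribution_exponent N \<delta>"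
  shows "\<delta> \<le> 1 / 2"
proof (rule ccontr)
  assume d: "\<not> \<delta> \<le> 1 / 2"
  have cov: "0 < covolume" by (rule covolume_pos[OF N equi])
  obtain C T0 where C: "0 < C" "1 \<le> T0"
    "\<And>T \<epsilon>. T0 \<le> T \<Longrightarrow> eig_ball N T \<noteq> {} \<Longrightarrow> 0 < \<epsilon> \<Longrightarrow> \<epsilon> \<le> 1 / 2 \<Longrightarrow>
       \<exists>I. 0 \<le> I \<and> I \<le> C * real (card (eig_ball N T)) * \<epsilon>^3 \<and>
         real (card (eig_ball N T)) * \<epsilon> \<le> 2 * T / covolume * I + C * (1 + T powr (1 - \<delta>))"
    using eig_ball_discrepancy[OF N equi] by metis
  \<comment> \<open>Chosen so that \<open>T powr (1 / 2)\<close> and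
    \<open>T powr (3 / 2 - \<delta>)\<close>, the two parts of the error times
    \<open>sqrt T\<close>, are at most \<open>T powr (1 - \<rho>)\<close>.\<close>
  define \<rho> where "\<rho> = min (1 / 2) (\<delta> - 1 / 2)"
  have \<rho>: "0 < \<rho>" "\<rho> \<le> 1 / 2" "\<rho> \<le> \<delta> - 1 / 2" using d unfolding \<rho>_def by linarith+
  \<comment> \<open>At width \<open>\<kappa> / sqrt T\<close> the main term is at most
    \<open>2 * C * \<kappa>^2 / covolume\<close> times the lower bound for the orbit sum; this
    choice makes the factor at most 1/2.\<close>
  define \<kappa> where "\<kappa> = min (1 / 2) (sqrt (covolume / (4 * C)))"
  have \<kappa>: "0 < \<kappa>" "\<kappa> \<le> 1 / 2" using cov C(1) by (auto simp: \<kappa>_def)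
  have "\<kappa>\<^sup>2 \<le> (sqrt (covolume / (4 * C)))\<^sup>2" using \<kappa> by (intro power_mono) (auto simp: \<kappa>_def)
  then have \<kappa>2: "\<kappa>\<^sup>2 \<le> covolume / (4 * C)" using cov C(1) by simp
  obtain T where T: "T0 \<le> T" "4 * C / \<kappa> * T powr (1 - \<rho>) < real (card (eig_ball N T))"
    using card_eig_ball_superpower[OF N \<rho>(1)] by metis
  have T1: "1 \<le> T" using C(2) T(1) by linarith
  define n where "n = real (card (eig_ball N T))"
  have "0 \<le> 4 * C / \<kappa> * T powr (1 - \<rho>)" using C(1) \<kappa> by simp
  then have ne: "eig_ball N T \<noteq> {}" using T(2) by auto
  define r where "r = sqrt T"
  have r: "1 \<le> r" "T = r\<^sup>2" using T1 by (auto simp: r_def)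
  have "\<kappa> / r \<le> \<kappa> / 1" using r \<kappa> by (intro divide_left_mono) auto
  then have eps: "0 < \<kappa> / r" "\<kappa> / r \<le> 1 / 2" using \<kappa> r by (simp, linarith)
  obtain I where I: "0 \<le> I" "I \<le> C * n * (\<kappa> / r)^3" "n * (\<kappa> / r) \<le> 2 * T / covolume * I + C * (1 + T powr (1 - \<delta>))"
    using C(3)[OF T(1) ne eps] unfolding n_def by blast
  have "2 * T / covolume * I \<le> 2 * T / covolume * (C * n * (\<kappa> / r)^3)"
    using I(2) T1 cov by (intro mult_left_mono) auto
  also have "\<dots> = \<kappa>\<^sup>2 * (2 * C / covolume * (n * (\<kappa> / r)))"
    using r by (simp add: r(2) power2_eq_square power3_eq_cube)
  also have "\<dots> \<le> covolume / (4 * C) * (2 * C / covolume * (n * (\<kappa> / r)))"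
    
    using \<kappa>2 \<kappa>(1) r(1) C(1) cov by (intro mult_right_mono mult_nonneg_nonneg divide_nonneg_nonneg) (auto simp: n_def)
  also have "\<dots> = n * (\<kappa> / r) / 2" using C(1) cov by (simp add: mult_ac)
  finally have "2 * T / covolume * I \<le> n * (\<kappa> / r) / 2" .
  moreover have "x \<le> 2 * c" if "y \<le> x / 2" "x \<le> y + c" for x y c :: real using that by linarith
  ultimately have "n * (\<kappa> / r) \<le> 2 * (C * (1 + T powr (1 - \<delta>)))" using I(3) by blast
  then have "n * (\<kappa> / r) * r \<le> 2 * (C * (1 + T powr (1 - \<delta>))) * r" using r by (intro mult_right_mono) auto
  moreover have "n * (\<kappa> / r) * r = n * \<kappa>" using r by simp
  moreover have "r = T powr (1 / 2)" using T1 by (simp add: r_def powr_half_sqrt)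
  then have "(1 + T powr (1 - \<delta>)) * r = T powr (1 / 2) + T powr (3 / 2 - \<delta>)"
    using T1 by (simp add: distrib_right flip: powr_add)
  moreover have "T powr (1 / 2) + T powr (3 / 2 - \<delta>) \<le> T powr (1 - \<rho>) + T powr (1 - \<rho>)"
    using T1 \<rho> by (intro add_mono powr_mono) auto
  then have "2 * C * (T powr (1 / 2) + T powr (3 / 2 - \<delta>)) \<le> 2 * C * (T powr (1 - \<rho>) + T powr (1 - \<rho>))"
    using C(1) by (intro mult_left_mono) auto
  moreover have "2 * (C * (1 + T powr (1 - \<delta>))) * r = 2 * C * ((1 + T powr (1 - \<delta>)) * r)" by simp
  ultimately have "n * \<kappa> \<le> 2 * C * (T powr (1 - \<rho>) + T powr (1 - \<rho>))" by simp
  then have "n \<le> 4 * C / \<kappa> * T powr (1 - \<rho>)" using \<kappa> by (simp add: field_simps)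
  then show False using T(2) by (simp add: n_def)
qed

section \<open>The rate for diophantine slopes\<close>

text \<open>A single tent at \<open>v\<close> of width \<open>K * T powr (- \<alpha>)\<close> has a
  main term of order \<open>T powr (1 - 3 * \<alpha>)\<close>. This is the order of the error for
  \<open>\<alpha> = 2 * \<delta> / (3 * b)\<close>, and a large \<open>K\<close> makes the main term
  win. A positive orbit sum then exhibits an orbit point under the tent.\<close>

lemma diophantine_approximation_rate:
  assumes N: "matrix_norm N" and equi: "equidistribution_exponent N \<delta>"
    and v: "v \<noteq> 0" and u1: "u$1 \<noteq> 0" and dio: "diophantine (ereal b) (u$2 / u$1)"
  shows "\<exists>C>0. \<exists>T0>0. \<forall>T\<ge>T0. \<exists>g\<in>SL2Z_ball N T. maxnorm (g *v u - v) < C * T powr (- (2 * \<delta> / (3 * b)))"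
proof -
  have b: "2 \<le> b" by (rule diophantine_ge_2[OF dio])
  have d: "0 < \<delta>" "\<delta> \<le> 1 / 2"
    using equi exponent_le_half[OF N equi] by (auto simp: equidistribution_exponent_def)
  have cov: "0 < covolume" by (rule covolume_pos[OF N equi])
  have u0: "u \<noteq> 0" using u1 by auto
  define w where "w = maxnorm v"
  have w: "0 < w" using v by (simp add: w_def maxnorm_pos_iff)
  define \<alpha> where "\<alpha> = 2 * \<delta> / (3 * b)"
  \<comment> \<open>\<open>3 * \<alpha> \<le> 1\<close> keeps
    \<open>T powr (1 - 3 * \<alpha>)\<close> at least 1, so that it dominates the constant part of
    the error.\<close>
  have \<alpha>: "0 < \<alpha>" "3 * \<alpha> \<le> 1" using d b by (auto simp: \<alpha>_def field_simps)
  obtain C T0 where C: "0 < C" "1 \<le> T0" "\<And>P \<epsilon> T. bump_function P \<epsilon> w w \<Longrightarrow> T0 \<le> T \<Longrightarrow>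
       \<bar>orbit_sum N (bump P \<epsilon>) u T
         - 2 * T / covolume * (LINT x:punctured_plane|lborel. bump P \<epsilon> x / star N x u)\<bar>
       \<le> C * (1 + T powr (1 - 2 * \<delta> / b))"
    by (rule bump_discrepancy[OF equi u1 dio w order_refl]) (rule that, assumption, assumption, blast)
  obtain l L where l: "0 < l" "\<And>x. l * maxnorm x \<le> star N x u" and L: "0 < L" "\<And>x. star N x u \<le> L * maxnorm x"
    using star_bounds[OF N u0] by metis
  define A where "A = 2 * covolume * L * w"
  have A: "0 < A" using cov L w by (simp add: A_def)
  \<comment> \<open>The main term is at least \<open>K^3 / A\<close> times \<open>Y\<close>, so this
    \<open>K\<close> makes it exceed the error \<open>2 * C * Y\<close> by \<open>Y\<close>;
    \<open>1 \<le> K\<close> gives \<open>K \<le> K^3\<close>.\<close>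
  define K where "K = max 1 (A * (2 * C + 1))"
  have K: "1 \<le> K" "A * (2 * C + 1) \<le> K" by (simp_all add: K_def)
  \<comment> \<open>The second entry forces \<open>\<epsilon> \<le> w / 2\<close>, so that the tent
    stays off the origin.\<close>
  define T1 where "T1 = max T0 ((2 * K / w) powr (1 / \<alpha>))"
  have "\<exists>g\<in>SL2Z_ball N T. maxnorm (g *v u - v) < K * T powr (- \<alpha>)" if T: "T1 \<le> T" for T
  proof -
    have T0: "T0 \<le> T" "1 \<le> T" "(2 * K / w) powr (1 / \<alpha>) \<le> T" using T C(2) by (auto simp: T1_def)
    define \<epsilon> where "\<epsilon> = K * T powr (- \<alpha>)"
    have \<epsilon>0: "0 < \<epsilon>" using K T0 by (simp add: \<epsilon>_def)
    have "((2 * K / w) powr (1 / \<alpha>)) powr \<alpha> \<le> T powr \<alpha>" using T0 \<alpha> by (intro powr_mono2) auto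
    then have "2 * K / w \<le> T powr \<alpha>" using \<alpha> K w by (simp add: powr_powr)
    then have "\<epsilon> \<le> w / 2" using T0 w by (simp add: \<epsilon>_def powr_minus field_simps)
    then interpret bump_function "{v}" \<epsilon> w w using \<epsilon>0 by unfold_locales (auto simp: w_def)
    define I where "I = (LINT x:punctured_plane|lborel. f x / star N x u)"
    define Y where "Y = T powr (1 - 3 * \<alpha>)"
    have Y: "1 \<le> Y" unfolding Y_def using T0 \<alpha> by (intro ge_one_powr_ge_zero) auto
    have "\<epsilon>^3 / (4 * L * w) \<le> I" unfolding I_def by (rule integral_bounds(2)[OF N u0 l L])
    then have "2 * T / covolume * (\<epsilon>^3 / (4 * L * w)) \<le> 2 * T / covolume * I"
      using T0 cov by (intro mult_left_mono) auto
    moreover have "T * \<epsilon>^3 = K^3 * Y"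
    proof -
      have "(T powr (- \<alpha>))^3 = T powr (- 3 * \<alpha>)" using T0 powr_powr[of T "- \<alpha>" 3] by (simp add: mult.commute)
      then show ?thesis using T0 by (simp add: \<epsilon>_def Y_def power_mult_distrib powr_diff powr_minus divide_inverse)
    qed
    then have "2 * T / covolume * (\<epsilon>^3 / (4 * L * w)) = K^3 * Y / A" by (simp add: A_def)
    moreover have "K^3 * Y / A \<ge> (2 * C + 1) * Y"
    proof -
      have "K * 1 \<le> K * K\<^sup>2" using K by (intro mult_left_mono) auto
      then have "A * (2 * C + 1) \<le> K^3" using K(2) by (simp add: eval_nat_numeral)
      then have "A * (2 * C + 1) * Y \<le> K^3 * Y" using Y by (intro mult_right_mono) auto
      then show ?thesis using A by (simp add: field_simps)
    qed
    moreover have "2 * \<delta> / b = 3 * \<alpha>" using b by (simp add: \<alpha>_def)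
    then have "2 * T / covolume * I - C * (1 + Y) \<le> orbit_sum N f u T"
      using C(3)[OF bump_function_axioms T0(1)] unfolding I_def Y_def by (simp add: abs_le_iff)
    moreover have "C * (1 + Y) \<le> C * (2 * Y)" using C(1) Y by (intro mult_left_mono) auto
    ultimately have "0 < orbit_sum N f u T" using Y by (simp add: algebra_simps)
    then obtain g where g: "g \<in> SL2Z_ball N T" "f (g *v u) \<noteq> 0"
      unfolding orbit_sum_def by (metis less_irrefl sum.neutral)
    then have "0 < f (g *v u)" using nonneg[of "g *v u"] by linarith
    then obtain p where "p \<in> {v}" "maxnorm (g *v u - p) < \<epsilon>" by (rule near_center)
    then show ?thesis using g(1) by (auto simp: \<epsilon>_def)
  qed
  moreover have "0 < T1" using C(2) by (simp add: T1_def less_max_iff_disj)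
  moreover have "0 < K" using K by simp
  ultimately show ?thesis unfolding \<alpha>_def by blast
qed

theorem corollary1p9:
  fixes N :: "real^2^2 \<Rightarrow> real" and \<delta>0 :: real and v u :: "real^2"
  assumes "matrix_norm N"
    and "equidistribution_exponent N \<delta>0"
    and "v \<in> punctured_plane" and "u \<in> punctured_plane"
  shows "(\<forall>\<beta>::ereal. 0 < \<beta> \<and> diophantine_slope \<beta> u \<longrightarrow>
           (\<exists>C>0. \<exists>T0>0. \<forall>T\<ge>T0. \<exists>g\<in>SL2Z_ball N T.
              maxnorm (g *v u - v) < C * T powr (- real_of_ereal (ereal (2 * \<delta>0) / (3 * \<beta>)))))
       \<and> (irrational_slope u \<longrightarrow>
           (\<exists>C>0. infinite {g \<in> SL2Z. maxnorm (g *v u - v) < C * N g powr (- (\<delta>0 / 3))}))"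
proof (intro conjI allI impI)
  note N = assms(1) and equi = assms(2)
  fix \<beta> :: ereal assume \<beta>: "0 < \<beta> \<and> diophantine_slope \<beta> u"
  then consider "\<beta> = \<infinity>" | b where "\<beta> = ereal b" "0 < b" by (cases \<beta>) auto
  then show "\<exists>C>0. \<exists>T0>0. \<forall>T\<ge>T0. \<exists>g\<in>SL2Z_ball N T.
              maxnorm (g *v u - v) < C * T powr (- real_of_ereal (ereal (2 * \<delta>0) / (3 * \<beta>)))"
  proof cases
    \<comment> \<open>The exponent of \<open>T\<close> is 0 because a real number divided by
      infinity is 0, and the identity matrix is a witness once its norm is at most
      \<open>T\<close>.\<close>
    case 1
    define T0 where "T0 = max 1 (N (mat 1))"
    have "\<exists>g\<in>SL2Z_ball N T. maxnorm (g *v u - v) < (maxnorm (u - v) + 1) * T powr (- real_of_ereal (ereal (2 * \<delta>0) / (3 * \<beta>)))"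
      if "T0 \<le> T" for T
    proof (rule bexI)
      show "mat 1 \<in> SL2Z_ball N T" using that by (auto simp: T0_def SL2Z_ball_def SL2Z_def) (auto simp: mat_def)
      show "maxnorm (mat 1 *v u - v) < (maxnorm (u - v) + 1) * T powr (- real_of_ereal (ereal (2 * \<delta>0) / (3 * \<beta>)))"
        using that 1 by (simp add: T0_def)
    qed
    moreover have "0 < T0" "0 < maxnorm (u - v) + 1" by (simp_all add: T0_def add_nonneg_pos)
    ultimately show ?thesis by blast
  next
    case 2
    have u: "u$1 \<noteq> 0" "diophantine (ereal b) (u$2 / u$1)"
      using \<beta> 2 by (auto simp: diophantine_slope_def split: if_splits)
    have "3 * \<beta> = ereal (3 * b)" using 2 by simp
    then have "real_of_ereal (ereal (2 * \<delta>0) / (3 * \<beta>)) = 2 * \<delta>0 / (3 * b)" using 2 by simp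
    then show ?thesis using diophantine_approximation_rate[OF N equi _ u, of v] assms(3)
      by (simp add: punctured_plane_def)
  qed
next
  assume "irrational_slope u"
  moreover have "0 < \<delta>0" using assms(2) by (simp add: equidistribution_exponent_def)
  moreover have "\<delta>0 \<le> 1 / 2" by (rule exponent_le_half[OF assms(1,2)])
  ultimately show "\<exists>C>0. infinite {g \<in> SL2Z. maxnorm (g *v u - v) < C * N g powr (- (\<delta>0 / 3))}"
    using assms(1) by (intro infinitely_many_approximations) auto
qed

end
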